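(* Let $(G_N)_{N\in\mathbb N}$ be a sequence of finite Abelian groups with $|G_N|\to\infty$ and $(k_N)_{N\in\mathbb N}$ a sequence of positive integers. Write $G=G_N$, $k=k_N$, and let $G_k^{+}$ (respectively $G_k^-$) be the directed (respectively undirected) random Cayley graph of $G$ with respect to $k$ independent uniformly random generators. Convergences are in probability as $N\to\infty$ and hold for each choice of sign. (1) Suppose $k/\log|G|\to\lambda\in(0,\infty)$, $d(G)\le\frac14\log|G|/\log\log|G|$ and $m_*(G)\to\infty$. Then $\mathrm{diam}\,G_k^\pm/(\alpha_\lambda^\pm k)\to1$. (2) Suppose $k/\log|G|\to\infty$ and $\log k/\log|G|\to0$. Write $\rho:=\log k/\log\log|G|$, so that $k=(\log|G|)^\rho$ ($\rho$ may depend on $N$ and may diverge). Then $\mathrm{diam}\,G_k^\pm\big/\big(\frac{\rho}{\rho-1}\log_k|G|\big)\to1$. In this regime, the upper bound holds for all finite groups, not only Abelian ones: for any sequence of finite groups $G=G_N$ with $|G_N|\to\infty$, and every $\varepsilon>0$, $\mathbb P\big(\mathrm{diam}\,G_k^\pm\le(1+\varepsilon)\frac{\rho}{\rho-1}\log_k|G|\big)\to1$. Moreover, the implicit lower bound holds for all Abelian groups and all choices of $k$ generators: in the regime $k/\log|G|\to\lambda\in(0,\infty)$ (respectively $k/\log|G|\to\infty$ with $\log k/\log|G|\to0$), with no further condition on the Abelian groups $G_N$, for all $\varepsilon>0$, for all sufficiently large $N$ and every multiset $z$ of $k$ elements of $G$, $\mathrm{diam}\,G^\pm(z)\ge(1-\varepsilon)\alpha^\pm_\lambda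 k$ (respectively $\mathrm{diam}\,G^\pm(z)\ge(1-\varepsilon)\frac{\rho}{\rho-1}\log_k|G|$).
   Context: For a finite group $G$ and a multiset $z=[z_1,\dots,z_k]$ of elements of $G$, the directed Cayley graph $G^+(z)$ has vertex set $G$ and edge multiset $[(g,gz_i): g\in G, i\le k]$; the undirected Cayley graph $G^-(z)$ has edge multiset $[\{g,gz_i\}: g\in G,i\le k]$. $G_k^\pm$ denotes $G^\pm(Z)$ with $Z=[Z_1,\dots,Z_k]$, where $Z_1,\dots,Z_k$ are independent and uniform on $G$. $\mathrm{diam}\,H$ is the maximal graph distance between (ordered) pairs of vertices of $H$ (along directed paths if $H$ is directed; $\infty$ if some vertex cannot be reached from another). For an Abelian group $G$, $d(G)$ is the minimal size of a generating subset of $G$, and $m_*(G):=\max\{\min_{j\in[d]}m_j : \oplus_{j=1}^d\mathbb Z_{m_j}\text{ is a decomposition of }G\}$, the maximum being over all decompositions of $G$ as a direct sum of cyclic groups. The constant $\alpha_\lambda^\pm\in(0,\infty)$ is the typical-distance constant: under the hypotheses of (1), for every $\beta\in(0,1)$, the minimal radius of a ball in $G_k^\pm$ around the identity containing at least $\beta|G|$ elements, divided by $\alpha_\lambda^\pm k$, tends to $1$ in probability. Explicitly, $\alpha_\lambda^\pm=(c^\pm)^{-1}(1/\lambda)$, where $c^\pm:(0,\infty)\to(0,\infty)$ is the strictly increasing continuous function $c^\pm(a):=\lim_{k\to\infty}\frac1k\log|B_k^\pm(ak)|$, with $B_k^-(R):=\{w\in\mathbb Z^k:\sum_i|w_i|\le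 R\}$ and $B_k^+(R):=\{w\in\mathbb Z_{\ge0}^k:\sum_i w_i\le R\}$. *)

theory Defs
  imports
    "HOL-Probability.Probability"
    "HOL-Algebra.Product_Groups"
    "HOL-Algebra.Elementary_Groups"
begin

datatype sign = Plus | Minus

text \<open>
  Edges of an undirected graph are sets of at most two vertices; the loop at \<open>g\<close> is \<open>{g}\<close>.
\<close>

definition directed_cayley_edges :: "('a, 'b) monoid_scheme \<Rightarrow> 'a multiset \<Rightarrow> ('a \<times> 'a) multiset" where
  "directed_cayley_edges G z =
     (\<Sum>x\<in>#z. image_mset (\<lambda>g. (g, g \<otimes>\<^bsub>G\<^esub> x)) (mset_set (carrier G)))"

definition undirected_cayley_edges :: "('a, 'b) monoid_scheme \<Rightarrow> 'a multiset \<Rightarrow> 'a set multiset" where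
  "undirected_cayley_edges G z =
     (\<Sum>x\<in>#z. image_mset (\<lambda>g. {g, g \<otimes>\<^bsub>G\<^esub> x}) (mset_set (carrier G)))"

fun cayley_adj :: "sign \<Rightarrow> ('a, 'b) monoid_scheme \<Rightarrow> 'a multiset \<Rightarrow> ('a \<times> 'a) set" where
  "cayley_adj Plus G z = {(u, v). (u, v) \<in># directed_cayley_edges G z}"
| "cayley_adj Minus G z = {(u, v). {u, v} \<in># undirected_cayley_edges G z}"

text \<open>
  \<open>(u, v) \<in> E ^^ n\<close> says that there is a walk with \<open>n\<close> edges from \<open>u\<close> to \<open>v\<close>; the infimum of
  the empty set in \<^typ>\<open>enat\<close> is \<open>\<infinity>\<close>.
\<close>

definition graph_dist :: "('a \<times> 'a) set \<Rightarrow> 'a \<Rightarrow> 'a \<Rightarrow> enat" where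
  "graph_dist E u v = (INF n \<in> {n. (u, v) \<in> E ^^ n}. enat n)"

definition graph_diam :: "'a set \<Rightarrow> ('a \<times> 'a) set \<Rightarrow> enat" where
  "graph_diam V E = (SUP u \<in> V. SUP v \<in> V. graph_dist E u v)"

definition cayley_diam :: "sign \<Rightarrow> ('a, 'b) monoid_scheme \<Rightarrow> 'a multiset \<Rightarrow> enat" where
  "cayley_diam s G z = graph_diam (carrier G) (cayley_adj s G z)"

definition random_generators :: "('a, 'b) monoid_scheme \<Rightarrow> nat \<Rightarrow> 'a multiset pmf" where
  "random_generators G k = map_pmf mset (replicate_pmf k (pmf_of_set (carrier G)))"

definition min_generators :: "('a, 'b) monoid_scheme \<Rightarrow> nat" where
  "min_generators G =
     (LEAST n. \<exists>S. S \<subseteq> carrier G \<and> finite S \<and> card S = n \<and> generate G S = carrier G)"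

text \<open>
  For finite \<open>G\<close> every \<open>m j\<close> is positive, since \<open>integer_mod_group 0\<close> is infinite.
  Trivial factors are allowed; for nontrivial \<open>G\<close> they do not change the maximum.
\<close>

definition m_star :: "('a, 'b) monoid_scheme \<Rightarrow> nat" where
  "m_star G = Max {Min (m ` {..<d}) | d m. d > 0 \<and>
     G \<cong> sum_group {..<d} (\<lambda>j::nat. integer_mod_group (m j))}"

text \<open>Vectors indexed by \<open>{..<k}\<close>, represented by functions that are undefined elsewhere.\<close>

fun lattice_ball :: "sign \<Rightarrow> nat \<Rightarrow> real \<Rightarrow> (nat \<Rightarrow> int) set" where
  "lattice_ball Plus k R = {w \<in> {..<k} \<rightarrow>\<^sub>E {0..}. real_of_int (\<Sum>i<k. w i) \<le> R}"
| "lattice_ball Minus k R = {w \<in> {..<k} \<rightarrow>\<^sub>E UNIV. real_of_int (\<Sum>i<k. \<bar>w i\<bar>) \<le> R}"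

definition ball_growth :: "sign \<Rightarrow> real \<Rightarrow> real" where
  "ball_growth s a = lim (\<lambda>k. ln (real (card (lattice_ball s k (a * real k)))) / real k)"

definition alpha :: "sign \<Rightarrow> real \<Rightarrow> real" where
  "alpha s l = the_inv_into {0<..} (ball_growth s) (1 / l)"

definition tendsto_in_prob :: "(nat \<Rightarrow> 'w pmf) \<Rightarrow> (nat \<Rightarrow> 'w \<Rightarrow> ereal) \<Rightarrow> real \<Rightarrow> bool" where
  "tendsto_in_prob P X c \<longleftrightarrow>
     (\<forall>\<epsilon>>0. (\<lambda>N. measure_pmf.prob (P N) {w. \<bar>X N w - ereal c\<bar> > ereal \<epsilon>}) \<longlonglongrightarrow> 0)"

end

theory Submission
  imports Defs "HOL-Real_Asymp.Real_Asymp"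
begin

text \<open>
  Lower bounds: in an Abelian group the ball of radius \<open>R\<close> is an image of the lattice ball, whose size
  is at most \<open>t powr (- R) * ((1 + t) / (1 - t)) ^ k\<close>; for \<open>R = a * k\<close> superadditivity of the
  logarithm gives the bound \<open>exp (k * ball_growth s a)\<close> for every \<open>k\<close>.

  Upper bounds: choose a family \<open>W\<close> of words of length at most \<open>R\<close> with \<open>|W| \<ge> |G| powr (1 + \<epsilon>)\<close> in
  part of the generators, such that the values of two words are nearly pairwise independent. By
  Chebyshev the values of \<open>W\<close> miss only a vanishing proportion of \<open>G\<close>, and one further step along one
  of the remaining generators (there are at least of order \<open>ln |G|\<close> of them) then reaches all of \<open>G\<close>.
  For \<open>k\<close> much larger than \<open>ln |G|\<close> the family consists of increasing products of distinct
  generators, which are exactly pairwise independent in any group. For \<open>k\<close> of order \<open>ln |G|\<close> it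
  consists of products of lattice balls of a fixed dimension \<open>K\<close>, so that the exponents stay bounded,
  together with free exponents in \<open>{0, 1}\<close>. Dependence then only comes from the torsion of bounded
  order, of which there is at most \<open>C ^ d(G) = |G| powr o(1)\<close>.
\<close>

section \<open>Lattice balls\<close>

text \<open>Lower and upper bound meet because both compare \<open>|G|\<close> with the number of
  words: fewer than \<open>|G|\<close> words cannot cover \<open>G\<close>, and
  \<open>|G| powr (1 + \<epsilon>)\<close> nearly independent words cover almost all of it, at a
  radius that differs by a factor close to 1.

  The obstacle is the passage from almost all vertices to all. The second moment bounds the missed
  proportion by roughly \<open>|G| / |W|\<close>, far above \<open>1 / |G|\<close>, so a union bound
  over the targets fails. With \<open>J\<close> of order \<open>ln |G|\<close> generators kept back
  for the last step, a target fails with probability \<open>\<delta> ^ J\<close> where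
  \<open>\<delta>\<close> tends to 0, and this beats \<open>|G|\<close>. The step costs 1, which is
  negligible because both radii diverge.

  For \<open>k\<close> of order \<open>ln |G|\<close> a full ball contains words with very large
  exponents \<open>r\<close>, and then the \<open>r\<close>-torsion may be most of \<open>G\<close>.
  Blocks of dimension \<open>K\<close> cap the exponents by a constant. Of every
  \<open>K + 2\<close> generators one carries a free binary exponent and one is kept for the last
  step; the loss in radius and in entropy vanishes as \<open>K\<close> grows, so a large fixed
  \<open>K\<close> is enough.\<close>

definition word_ball :: "sign \<Rightarrow> nat \<Rightarrow> real \<Rightarrow> int list set" where
  "word_ball s k R = {w. length w = k \<and> real_of_int (\<Sum>i\<leftarrow>w. \<bar>i\<bar>) \<le> R \<and>
     (s = Plus \<longrightarrow> (\<forall>i\<in>set w. 0 \<le> i))}"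

lemma sum_list_abs_nonneg: "0 \<le> (\<Sum>i\<leftarrow>w. \<bar>i::int\<bar>)"
  by (rule sum_list_nonneg) auto

lemma abs_le_sum_list_abs: "i \<in> set w \<Longrightarrow> \<bar>i::int\<bar> \<le> (\<Sum>i\<leftarrow>w. \<bar>i\<bar>)"
  by (induction w) (use sum_list_abs_nonneg in fastforce)+

lemma word_ball_neg: "R < 0 \<Longrightarrow> word_ball s k R = {}"
  using of_int_0_le_iff[where ?'a = real, THEN iffD2, OF sum_list_abs_nonneg]
  unfolding word_ball_def by (smt (verit, ccfv_threshold) Collect_empty_eq)

lemma word_ball_bound:
  assumes "w \<in> word_ball s k R" "i \<in> set w"
  shows "real_of_int \<bar>i\<bar> \<le> R"
  using abs_le_sum_list_abs[OF assms(2)] assms(1) unfolding word_ball_def by simp linarith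

lemma finite_word_ball: "finite (word_ball s k R)"
proof (rule finite_subset)
  show "word_ball s k R \<subseteq> {w. set w \<subseteq> {-\<lfloor>R\<rfloor>..\<lfloor>R\<rfloor>} \<and> length w = k}"
  proof
    fix w assume w: "w \<in> word_ball s k R"
    have "\<bar>i\<bar> \<le> \<lfloor>R\<rfloor>" if "i \<in> set w" for i
      using word_ball_bound[OF w that] by (simp add: le_floor_iff)
    then show "w \<in> {w. set w \<subseteq> {-\<lfloor>R\<rfloor>..\<lfloor>R\<rfloor>} \<and> length w = k}"
      using w by (fastforce simp: word_ball_def)
  qed
qed (rule finite_lists_length_eq, simp)

lemma word_ball_mono: "R \<le> R' \<Longrightarrow> word_ball s k R \<subseteq> word_ball s k R'"
  by (auto simp: word_ball_def)

lemma zero_in_word_ball: "0 \<le> R \<Longrightarrow> replicate k 0 \<in> word_ball s k R"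
  by (auto simp: word_ball_def sum_list_replicate)

lemma card_word_ball_pos: "0 \<le> R \<Longrightarrow> 0 < card (word_ball s k R)"
  using zero_in_word_ball finite_word_ball card_gt_0_iff by blast

text \<open>Lists replace extensional functions because products of balls become \<open>@\<close>
  and induction on the dimension becomes \<open>Cons\<close>. On nonnegative entries the sum and the
  sum of absolute values agree, so a single norm serves both signs.\<close>

lemma card_lattice_ball: "card (lattice_ball s k R) = card (word_ball s k R)"
proof -
  let ?f = "\<lambda>w. map w [0..<k]" and ?g = "\<lambda>v. \<lambda>i\<in>{..<k}. v ! i"
  have sums: "(\<Sum>i\<leftarrow>map w [0..<k]. \<bar>i\<bar>) = (\<Sum>i<k. \<bar>w i\<bar>)" for w :: "nat \<Rightarrow> int"
    by (simp add: o_def interv_sum_list_conv_sum_set_nat atLeast0LessThan)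
  have "bij_betw ?f (lattice_ball s k R) (word_ball s k R)"
  proof (rule bij_betw_byWitness[where f' = ?g])
    show "\<forall>a\<in>lattice_ball s k R. ?g (?f a) = a"
      by (cases s) (auto simp: PiE_def extensional_def fun_eq_iff)
    show "\<forall>a'\<in>word_ball s k R. ?f (?g a') = a'"
      by (auto simp: word_ball_def intro!: nth_equalityI)
    show "?f ` lattice_ball s k R \<subseteq> word_ball s k R"
    proof
      fix v assume "v \<in> ?f ` lattice_ball s k R"
      then obtain w where w: "w \<in> lattice_ball s k R" and v: "v = ?f w" by blast
      have "real_of_int (\<Sum>i<k. \<bar>w i\<bar>) \<le> R \<and> (s = Plus \<longrightarrow> (\<forall>i<k. 0 \<le> w i))"
      proof (cases s)
        case Plus
        then have nn: "\<forall>i<k. 0 \<le> w i" and le: "real_of_int (\<Sum>i<k. w i) \<le> R"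
          using w by (simp_all add: PiE_iff)
        have "(\<Sum>i<k. \<bar>w i\<bar>) = (\<Sum>i<k. w i)"
          using nn by (intro sum.cong) simp_all
        with nn le show ?thesis by metis
      next
        case Minus
        then show ?thesis
          using w unfolding Minus lattice_ball.simps mem_Collect_eq by (metis sign.distinct(1))
      qed
      then show "v \<in> word_ball s k R"
        unfolding word_ball_def mem_Collect_eq v sums by simp
    qed
    show "?g ` word_ball s k R \<subseteq> lattice_ball s k R"
    proof
      fix w assume "w \<in> ?g ` word_ball s k R"
      then obtain v where v: "v \<in> word_ball s k R" and w: "w = ?g v" by blast
      have mv: "map w [0..<k] = v"
        using v by (auto simp: word_ball_def w intro!: nth_equalityI)
      have sw: "real_of_int (\<Sum>i<k. \<bar>w i\<bar>) \<le> R"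
        using v unfolding sums[symmetric] mv by (simp add: word_ball_def)
      show "w \<in> lattice_ball s k R"
      proof (cases s)
        case Plus
        have nn: "\<forall>i<k. 0 \<le> w i"
          using v Plus by (auto simp: word_ball_def w)
        then have "(\<Sum>i<k. w i) = (\<Sum>i<k. \<bar>w i\<bar>)"
          by (intro sum.cong) auto
        with sw nn Plus show ?thesis
          by (auto simp: w PiE_iff)
      next
        case Minus
        then show ?thesis using sw by (simp add: w PiE_iff)
      qed
    qed
  qed
  then show ?thesis by (rule bij_betw_same_card)
qed

lemma append_in_word_ball:
  "u \<in> word_ball s k R \<Longrightarrow> v \<in> word_ball s l R' \<Longrightarrow> u @ v \<in> word_ball s (k + l) (R + R')"
  by (auto simp: word_ball_def)

lemma card_word_ball_add:
  "card (word_ball s k R) * card (word_ball s l R') \<le> card (word_ball s (k + l) (R + R'))"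
proof -
  have "card (word_ball s k R \<times> word_ball s l R') \<le> card (word_ball s (k + l) (R + R'))"
  proof (rule card_inj_on_le[where f = "\<lambda>(u, v). u @ v"])
    show "inj_on (\<lambda>(u, v). u @ v) (word_ball s k R \<times> word_ball s l R')"
      by (auto simp: inj_on_def word_ball_def)
  qed (use append_in_word_ball finite_word_ball in auto)
  then show ?thesis by (simp add: card_cartesian_product)
qed

text \<open>Chernoff bound: weighting \<open>w\<close> by \<open>t ^ |w|\<close> turns the ball into a product of geometric series.\<close>

lemma card_word_ball_le:
  assumes t: "0 < t" "t < 1"
  shows "real (card (word_ball s k R)) \<le> t powr (- R) * ((1 + t) / (1 - t)) ^ k"
proof (induction k arbitrary: R)
  case 0
  have "word_ball s 0 R \<subseteq> {[]}" by (auto simp: word_ball_def)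
  then have c: "card (word_ball s 0 R) \<le> 1"
    using card_mono[of "{[]}" "word_ball s 0 R"] by simp
  show ?case
  proof (cases "R < 0")
    case False
    then have "1 \<le> t powr (- R)"
      using t powr_mono'[of "-R" 0 t] by simp
    with c show ?thesis by simp
  qed (simp add: word_ball_neg)
next
  case (Suc k)
  \<comment> \<open>\<open>M\<close> bounds the first coordinate; the absolute value covers negative
    \<open>R\<close>, for which the ball is empty.\<close>
  define M where "M = nat \<lfloor>\<bar>R\<bar>\<rfloor>"
  let ?I = "{- int M..int M}"
  have sub: "word_ball s (Suc k) R \<subseteq> (\<Union>i\<in>?I. (#) i ` word_ball s k (R - real_of_int \<bar>i\<bar>))"
  proof
    fix w assume w: "w \<in> word_ball s (Suc k) R"
    then obtain i v where wv: "w = i # v" by (auto simp: word_ball_def length_Suc_conv)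
    have "real_of_int \<bar>i\<bar> \<le> R" using word_ball_bound[OF w] wv by simp
    then have "\<bar>i\<bar> \<le> int M" unfolding M_def by linarith
    moreover have "v \<in> word_ball s k (R - real_of_int \<bar>i\<bar>)"
      using w wv by (auto simp: word_ball_def)
    ultimately show "w \<in> (\<Union>i\<in>?I. (#) i ` word_ball s k (R - real_of_int \<bar>i\<bar>))"
      using wv by (auto simp: abs_le_iff)
  qed
  let ?F = "(1 + t) / (1 - t)"
  \<comment> \<open>A partial sum of the series over all integers: \<open>1 / (1 - t)\<close> for
    the nonnegative ones plus \<open>1 / (1 - t) - 1\<close> for the negative ones.\<close>
  have geo: "(\<Sum>i\<in>?I. t ^ nat \<bar>i\<bar>) \<le> ?F"
  proof -
    have "x \<in> int ` {..M} \<union> (\<lambda>j. - int j) ` {1..M}" if "x \<in> ?I" for x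
    proof (cases "x \<ge> 0")
      case True
      then have "x = int (nat x)" "nat x \<in> {..M}" using that by auto
      then show ?thesis by blast
    next
      case False
      then have "x = - int (nat (- x))" "nat (- x) \<in> {1..M}" using that by auto
      then show ?thesis by blast
    qed
    then have "?I \<subseteq> int ` {..M} \<union> (\<lambda>j. - int j) ` {1..M}" by blast
    then have "(\<Sum>i\<in>?I. t ^ nat \<bar>i\<bar>) \<le>
        (\<Sum>i\<in>int ` {..M} \<union> (\<lambda>j. - int j) ` {1..M}. t ^ nat \<bar>i\<bar>)"
      using t by (intro sum_mono2) simp_all
    also have "\<dots> \<le> (\<Sum>i\<in>int ` {..M}. t ^ nat \<bar>i\<bar>) + (\<Sum>i\<in>(\<lambda>j. - int j) ` {1..M}. t ^ nat \<bar>i\<bar>)"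
      using t by (subst sum_Un) (simp_all add: sum_nonneg)
    also have "(\<Sum>i\<in>int ` {..M}. t ^ nat \<bar>i\<bar>) = (\<Sum>j\<le>M. t ^ j)"
      by (subst sum.reindex) (simp_all add: inj_on_def)
    also have "(\<Sum>i\<in>(\<lambda>j. - int j) ` {1..M}. t ^ nat \<bar>i\<bar>) = (\<Sum>j=1..M. t ^ j)"
      by (subst sum.reindex) (simp_all add: inj_on_def)
    finally have le: "(\<Sum>i\<in>?I. t ^ nat \<bar>i\<bar>) \<le> (\<Sum>j\<le>M. t ^ j) + (\<Sum>j=1..M. t ^ j)" .
    have "(\<Sum>j\<le>M. t ^ j) = 1 + (\<Sum>j=1..M. t ^ j)"
      by (induction M) simp_all
    moreover have "(\<Sum>j\<le>M. t ^ j) \<le> 1 / (1 - t)"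
      using t by (simp add: sum_gp0 divide_right_mono)
    moreover have "1 / (1 - t) + (1 / (1 - t) - 1) = ?F"
      using t by (simp add: field_simps)
    ultimately show ?thesis using le by linarith
  qed
  have "card (word_ball s (Suc k) R) \<le> (\<Sum>i\<in>?I. card ((#) i ` word_ball s k (R - real_of_int \<bar>i\<bar>)))"
    by (rule order_trans[OF card_mono[OF _ sub] card_UN_le]) (auto simp: finite_word_ball)
  also have "\<dots> \<le> (\<Sum>i\<in>?I. card (word_ball s k (R - real_of_int \<bar>i\<bar>)))"
    by (intro sum_mono card_image_le finite_word_ball)
  finally have "card (word_ball s (Suc k) R) \<le> (\<Sum>i\<in>?I. card (word_ball s k (R - real_of_int \<bar>i\<bar>)))" .
  from of_nat_mono[OF this, where ?'a = real]
  have "real (card (word_ball s (Suc k) R)) \<le> (\<Sum>i\<in>?I. real (card (word_ball s k (R - real_of_int \<bar>i\<bar>))))"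
    unfolding of_nat_sum .
  also have "\<dots> \<le> (\<Sum>i\<in>?I. t powr (- R) * ?F ^ k * t ^ nat \<bar>i\<bar>)"
  proof (rule sum_mono)
    fix i :: int
    have "t powr (- (R - real_of_int \<bar>i\<bar>)) = t powr (- R + real (nat \<bar>i\<bar>))"
      by simp
    also have "\<dots> = t powr (- R) * t ^ nat \<bar>i\<bar>"
      unfolding powr_add powr_realpow[OF t(1)] ..
    finally have "t powr (- (R - real_of_int \<bar>i\<bar>)) = t powr (- R) * t ^ nat \<bar>i\<bar>" .
    with Suc.IH[of "R - real_of_int \<bar>i\<bar>"]
    show "real (card (word_ball s k (R - real_of_int \<bar>i\<bar>))) \<le> t powr (- R) * ?F ^ k * t ^ nat \<bar>i\<bar>"
      by (simp add: mult_ac)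
  qed
  also have "\<dots> = t powr (- R) * ?F ^ k * (\<Sum>i\<in>?I. t ^ nat \<bar>i\<bar>)"
    by (simp add: sum_distrib_left)
  also have "\<dots> \<le> t powr (- R) * ?F ^ k * ?F"
    using geo t by (intro mult_left_mono mult_nonneg_nonneg zero_le_power) auto
  finally show ?case by (simp add: mult_ac)
qed

section \<open>Superadditivity and the growth rate of balls\<close>

lemma superadditive_tendsto:
  fixes u :: "nat \<Rightarrow> real"
  assumes super: "\<And>m n. u m + u n \<le> u (m + n)"
    and nonneg: "\<And>n. 0 \<le> u n" and bound: "\<And>n. u n \<le> C * real n"
  obtains L where "(\<lambda>n. u n / real n) \<longlonglongrightarrow> L" "\<And>n. 0 < n \<Longrightarrow> u n / real n \<le> L"
proof
  \<comment> \<open>The limit is the supremum of the ratios, so every finite \<open>n\<close> obeys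
    the bound without an error term. The lower bound on the diameter for \<open>k\<close> of order
    \<open>ln |G|\<close> relies on this.\<close>
  define L where "L = (SUP n\<in>{0<..}. u n / real n)"
  have bdd: "bdd_above ((\<lambda>n. u n / real n) ` {0<..})"
    using bound by (intro bdd_aboveI[of _ C]) (auto simp: divide_le_eq)
  show upper: "u n / real n \<le> L" if "0 < n" for n
    unfolding L_def using that bdd by (intro cSUP_upper) auto
  \<comment> \<open>Fekete's argument: \<open>n\<close> splits into \<open>n div m\<close> blocks of
    size \<open>m\<close>, and the remainder may be dropped because \<open>u\<close> is
    nonnegative.\<close>
  have mult: "real q * u m \<le> u (q * m)" for q m
  proof (induction q)
    case (Suc q)
    then show ?case using super[of m "q * m"] by (simp add: algebra_simps)
  qed (simp add: nonneg)
  show "(\<lambda>n. u n / real n) \<longlonglongrightarrow> L"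
  proof (rule order_tendstoI)
    fix a assume "a < L"
    then obtain m where m: "0 < m" "a < u m / real m"
      unfolding L_def using less_cSUP_iff[OF _ bdd] by auto
    have lower: "u m / real m - u m / real n \<le> u n / real n" if "0 < n" for n
    proof -
      have "real (n div m) * u m \<le> u n"
        using mult[of "n div m" m] super[of "n div m * m" "n mod m"] nonneg[of "n mod m"] by simp
      moreover have "real n / real m - 1 \<le> real (n div m)"
      proof -
        have "n \<le> (n div m + 1) * m"
          using m(1) by (simp add: dividend_less_times_div less_imp_le algebra_simps)
        then have "real n \<le> real (n div m + 1) * real m" unfolding of_nat_mult[symmetric] of_nat_le_iff .
        then show ?thesis using m(1) by (simp add: field_simps)
      qed
      ultimately have "(real n / real m - 1) * u m \<le> u n"
        using nonneg[of m] by (meson mult_right_mono order_trans)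
      then have "(real n / real m - 1) * u m / real n \<le> u n / real n"
        by (simp add: divide_right_mono)
      moreover have "(real n / real m - 1) * u m / real n = u m / real m - u m / real n"
        using that m(1) by (simp add: field_simps)
      ultimately show ?thesis by simp
    qed
    have "(\<lambda>n. u m / real m - u m / real n) \<longlonglongrightarrow> u m / real m - 0"
      by (intro tendsto_diff tendsto_const tendsto_divide_0[OF tendsto_const]
          filterlim_real_sequentially filterlim_at_top_imp_at_infinity)
    then have "\<forall>\<^sub>F n in sequentially. a < u m / real m - u m / real n"
      using m(2) by (intro order_tendstoD(1)) auto
    with eventually_gt_at_top[of 0] show "\<forall>\<^sub>F n in sequentially. a < u n / real n"
    proof eventually_elim
      case (elim n)
      with lower[of n] show ?case by linarith
    qed
  next
    fix a assume a: "L < a"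
    show "\<forall>\<^sub>F n in sequentially. u n / real n < a"
      using eventually_gt_at_top[of 0]
    proof eventually_elim
      case (elim n)
      with upper[of n] a show ?case by linarith
    qed
  qed
qed

lemma ln_card_word_ball_le:
  assumes "0 < t" "t < 1" "0 \<le> R"
  shows "ln (real (card (word_ball s k R))) \<le> - R * ln t + real k * ln ((1 + t) / (1 - t))"
proof -
  have "ln (real (card (word_ball s k R))) \<le> ln (t powr (- R) * ((1 + t) / (1 - t)) ^ k)"
    using card_word_ball_le[OF assms(1,2), of s k R] card_word_ball_pos[OF assms(3), of s k] assms
    by (subst ln_le_cancel_iff) auto
  also have "\<dots> = - R * ln t + real k * ln ((1 + t) / (1 - t))"
    using assms by (simp add: ln_mult ln_realpow ln_powr)
  finally show ?thesis .
qed

lemma ln_card_word_ball_nonneg: "0 \<le> R \<Longrightarrow> 0 \<le> ln (real (card (word_ball s k R)))"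
  using card_word_ball_pos[of R s k] by (simp add: Suc_leI)

lemma ln_card_word_ball_add:
  assumes "0 \<le> R" "0 \<le> R'"
  shows "ln (real (card (word_ball s k R))) + ln (real (card (word_ball s l R')))
    \<le> ln (real (card (word_ball s (k + l) (R + R'))))"
proof -
  have "real (card (word_ball s k R)) * real (card (word_ball s l R')) \<le> real (card (word_ball s (k + l) (R + R')))"
    using card_word_ball_add[of s k R l R'] unfolding of_nat_mult[symmetric] of_nat_le_iff .
  then show ?thesis
    using card_word_ball_pos[OF assms(1), of s k] card_word_ball_pos[OF assms(2), of s l]
      card_word_ball_pos[of "R + R'" s "k + l"] assms
    by (simp add: ln_mult_pos[symmetric])
qed

text \<open>The radius \<open>a * real k\<close> is not rounded, so the radii of two blocks add up
  exactly and the logarithm of the ball size is superadditive in \<open>k\<close>.\<close>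

lemma ball_growth_limit:
  assumes a: "0 < a"
  shows "(\<lambda>k. ln (real (card (word_ball s k (a * real k)))) / real k) \<longlonglongrightarrow> ball_growth s a"
    and "0 < k \<Longrightarrow> ln (real (card (word_ball s k (a * real k)))) / real k \<le> ball_growth s a"
proof -
  obtain L where L: "(\<lambda>k. ln (real (card (word_ball s k (a * real k)))) / real k) \<longlonglongrightarrow> L"
      "\<And>k. 0 < k \<Longrightarrow> ln (real (card (word_ball s k (a * real k)))) / real k \<le> L"
  proof (rule superadditive_tendsto[of "\<lambda>k. ln (real (card (word_ball s k (a * real k))))"])
    show "ln (real (card (word_ball s m (a * real m)))) + ln (real (card (word_ball s n (a * real n))))
        \<le> ln (real (card (word_ball s (m + n) (a * real (m + n)))))" for m n
      using ln_card_word_ball_add[of "a * real m" "a * real n" s m n] a by (simp add: distrib_left)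
    \<comment> \<open>The Chernoff bound at \<open>t = 1/2\<close>, where
      \<open>- ln t = ln 2\<close> and \<open>(1 + t) / (1 - t) = 3\<close>.\<close>
    show "ln (real (card (word_ball s n (a * real n)))) \<le> (a * ln 2 + ln 3) * real n" for n
      using ln_card_word_ball_le[of "1/2" "a * real n" s n] a by (simp add: ln_div algebra_simps)
  qed (use a in \<open>auto intro!: ln_card_word_ball_nonneg\<close>)
  moreover have "ball_growth s a = L"
    unfolding ball_growth_def card_lattice_ball by (rule limI) (rule L(1))
  ultimately show "(\<lambda>k. ln (real (card (word_ball s k (a * real k)))) / real k) \<longlonglongrightarrow> ball_growth s a"
    and "0 < k \<Longrightarrow> ln (real (card (word_ball s k (a * real k)))) / real k \<le> ball_growth s a"
    by simp_all
qed

lemma ball_growth_le: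
  assumes "0 < a" "0 < t" "t < 1"
  shows "ball_growth s a \<le> - a * ln t + ln ((1 + t) / (1 - t))"
proof (rule LIMSEQ_le_const2[OF ball_growth_limit(1)[OF assms(1)]], intro exI allI impI)
  fix k :: nat assume k: "1 \<le> k"
  have "ln (real (card (word_ball s k (a * real k)))) \<le> (- a * ln t + ln ((1 + t) / (1 - t))) * real k"
    using ln_card_word_ball_le[of t "a * real k" s k] assms by (simp add: algebra_simps)
  then show "ln (real (card (word_ball s k (a * real k)))) / real k \<le> - a * ln t + ln ((1 + t) / (1 - t))"
    using k by (simp add: divide_le_eq)
qed

text \<open>Dimension 1 already contains the words \<open>[i]\<close> with
  \<open>0 \<le> i \<le> a\<close>. The bound shows that the growth rate is unbounded, as strict
  monotonicity and the intermediate value argument for \<open>alpha\<close> require.\<close>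

lemma ball_growth_ge:
  assumes "0 < a"
  shows "ln a \<le> ball_growth s a"
proof -
  have "card ((\<lambda>i. [i]) ` {0..\<lfloor>a\<rfloor>}) \<le> card (word_ball s 1 a)"
    by (intro card_mono finite_word_ball) (auto simp: word_ball_def le_floor_iff)
  then have "real (nat (\<lfloor>a\<rfloor> + 1)) \<le> real (card (word_ball s 1 a))"
    by (subst (asm) card_image) (auto simp: inj_on_def)
  then have "a \<le> real (card (word_ball s 1 a))"
    using assms by linarith
  then have "ln a \<le> ln (real (card (word_ball s 1 a)))"
    using assms by simp
  with ball_growth_limit(2)[OF assms, of 1 s] show ?thesis by simp
qed

lemma ball_growth_mono:
  assumes "0 < a" "a \<le> b"
  shows "ball_growth s a \<le> ball_growth s b"
proof (rule LIMSEQ_le[OF ball_growth_limit(1) ball_growth_limit(1)])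
  show "0 < a" "0 < b" using assms by auto
  have "ln (real (card (word_ball s k (a * real k)))) / real k \<le> ln (real (card (word_ball s k (b * real k)))) / real k" for k
  proof -
  have "card (word_ball s k (a * real k)) \<le> card (word_ball s k (b * real k))"
    using assms by (intro card_mono finite_word_ball word_ball_mono mult_right_mono) auto
  moreover have "0 < card (word_ball s k (a * real k))" using assms by (simp add: card_word_ball_pos)
  ultimately show ?thesis
    by (intro divide_right_mono) auto
  qed
  then show "\<exists>N. \<forall>k\<ge>N. ln (real (card (word_ball s k (a * real k)))) / real k
      \<le> ln (real (card (word_ball s k (b * real k)))) / real k" by blast
qed

text \<open>A ball of relative radius \<open>(1 - t) * b + t * a\<close> contains the product of a ball of relative
  radius \<open>a\<close> in a proportion \<open>t\<close> of the coordinates and one of relative radius \<open>b\<close> in the others.\<close>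

lemma ball_growth_concave:
  assumes a: "0 < a" and ab: "a < b" and t: "0 < t" "t < 1"
  shows "(1 - t) * ball_growth s b + t * ball_growth s a \<le> ball_growth s ((1 - t) * b + t * a)"
proof -
  define c where "c = (1 - t) * b + t * a"
  have c: "0 < c" using a ab t unfolding c_def by (intro add_pos_pos mult_pos_pos) auto
  \<comment> \<open>Rounding up hands the smaller radius \<open>a\<close> to more coordinates, so
    the total radius cannot exceed \<open>c * real k\<close>.\<close>
  define i where "i k = nat \<lceil>t * real k\<rceil>" for k :: nat
  define j where "j k = k - i k" for k
  have i_ge: "t * real k \<le> real (i k)" and i_le: "real (i k) \<le> t * real k + 1" for k
    using t unfolding i_def by (auto simp: of_nat_nat intro: of_int_ceiling_le_add_one)
  have i_le_k: "i k \<le> k" for k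
    using t mult_right_mono[of t 1 "real k"] unfolding i_def by (simp add: nat_le_iff ceiling_le_iff)
  have j_eq: "real (j k) = real k - real (i k)" for k
    using i_le_k by (simp add: j_def of_nat_diff)
  define u where "u x k = ln (real (card (word_ball s k (x * real k))))" for x and k :: nat
  have super: "u b (j k) + u a (i k) \<le> u c k" for k
  proof -
    have "u b (j k) + u a (i k) \<le> ln (real (card (word_ball s (j k + i k) (b * real (j k) + a * real (i k)))))"
      unfolding u_def using a ab by (intro ln_card_word_ball_add) auto
    also have "\<dots> \<le> u c k"
    proof -
      have "(b - a) * (t * real k) \<le> (b - a) * real (i k)"
        using i_ge ab by (intro mult_left_mono) auto
      then have "b * real (j k) + a * real (i k) \<le> c * real k"
        unfolding j_eq c_def by (simp add: algebra_simps)
      then have "word_ball s k (b * real (j k) + a * real (i k)) \<subseteq> word_ball s k (c * real k)"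
        by (rule word_ball_mono)
      moreover have "j k + i k = k" using i_le_k by (simp add: j_def)
      moreover have "0 < card (word_ball s k (b * real (j k) + a * real (i k)))"
        using a ab by (intro card_word_ball_pos) auto
      ultimately show ?thesis
        unfolding u_def using card_mono[OF finite_word_ball, of "word_ball s k (b * real (j k) + a * real (i k))" s k "c * real k"]
        by (subst ln_le_cancel_iff) auto
    qed
    finally show ?thesis .
  qed
  have i_lim: "(\<lambda>k. real (i k) / real k) \<longlonglongrightarrow> t"
  proof (rule real_tendsto_sandwich[OF _ _ tendsto_const])
    show "\<forall>\<^sub>F k in sequentially. t \<le> real (i k) / real k"
      using eventually_gt_at_top[of 0] by eventually_elim (use i_ge in \<open>simp add: pos_le_divide_eq\<close>)
    show "\<forall>\<^sub>F k in sequentially. real (i k) / real k \<le> t + 1 / real k"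
      using eventually_gt_at_top[of 0] by eventually_elim (use i_le in \<open>simp add: field_simps\<close>)
    show "(\<lambda>k. t + 1 / real k) \<longlonglongrightarrow> t"
      using tendsto_add[OF tendsto_const[of t] lim_1_over_n] by simp
  qed
  have j_lim: "(\<lambda>k. real (j k) / real k) \<longlonglongrightarrow> 1 - t"
  proof (rule Lim_transform_eventually)
    show "(\<lambda>k. 1 - real (i k) / real k) \<longlonglongrightarrow> 1 - t"
      by (intro tendsto_diff tendsto_const i_lim)
    show "\<forall>\<^sub>F k in sequentially. 1 - real (i k) / real k = real (j k) / real k"
      using eventually_gt_at_top[of 0] by eventually_elim (simp add: j_eq diff_divide_distrib)
  qed
  have to_top: "filterlim f at_top sequentially"
    if lim: "(\<lambda>k. real (f k) / real k) \<longlonglongrightarrow> r" and r: "0 < r" for f :: "nat \<Rightarrow> nat" and r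
  proof -
    have top: "filterlim (\<lambda>k. real (f k) / real k * real k) at_top sequentially"
      by (rule filterlim_tendsto_pos_mult_at_top[OF lim r filterlim_real_sequentially])
    have ev: "\<forall>\<^sub>F k in sequentially. real (f k) / real k * real k = real (f k)"
      using eventually_gt_at_top[of 0] by eventually_elim simp
    have "filterlim (\<lambda>k. real (f k)) at_top sequentially"
      using top unfolding filterlim_cong[OF refl refl ev] .
    then have "\<forall>\<^sub>F k in sequentially. real Z \<le> real (f k)" for Z
      unfolding filterlim_at_top by blast
    then show ?thesis unfolding filterlim_at_top by simp
  qed
  \<comment> \<open>A proportion \<open>r\<close> of the coordinates contributes \<open>r\<close>
    times the growth rate, since \<open>f k\<close> itself tends to infinity.\<close>
  have part: "(\<lambda>k. u x (f k) / real k) \<longlonglongrightarrow> r * ball_growth s x"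
    if lim: "(\<lambda>k. real (f k) / real k) \<longlonglongrightarrow> r" and r: "0 < r" and x: "0 < x" for f :: "nat \<Rightarrow> nat" and r x
  proof (rule Lim_transform_eventually)
    have f_top: "filterlim f sequentially sequentially" using to_top[OF lim r] .
    show "(\<lambda>k. real (f k) / real k * (u x (f k) / real (f k))) \<longlonglongrightarrow> r * ball_growth s x"
      using filterlim_compose[OF ball_growth_limit(1)[OF x, of s] f_top] unfolding u_def
      by (intro tendsto_mult lim)
    show "\<forall>\<^sub>F k in sequentially. real (f k) / real k * (u x (f k) / real (f k)) = u x (f k) / real k"
      using to_top[OF lim r, unfolded filterlim_at_top, rule_format, of 1]
      by eventually_elim simp
  qed
  have lim1: "(\<lambda>k. u b (j k) / real k + u a (i k) / real k) \<longlonglongrightarrow> (1 - t) * ball_growth s b + t * ball_growth s a"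
    using part[OF j_lim] part[OF i_lim] a ab t by (intro tendsto_add) auto
  have lim2: "(\<lambda>k. u c k / real k) \<longlonglongrightarrow> ball_growth s c"
    unfolding u_def by (rule ball_growth_limit(1)[OF c])
  have "u b (j k) / real k + u a (i k) / real k \<le> u c k / real k" for k
    using super[of k] by (simp add: divide_right_mono flip: add_divide_distrib)
  then have "\<exists>N. \<forall>k\<ge>N. u b (j k) / real k + u a (i k) / real k \<le> u c k / real k"
    by (intro exI allI impI)
  from LIMSEQ_le[OF lim1 lim2 this] show ?thesis
    unfolding c_def .
qed

text \<open>Concavity is wanted for two consequences: continuity, because the domain is open, and
  strict monotonicity.\<close>

lemma concave_on_ball_growth: "concave_on {0<..} (ball_growth s)"
proof (rule concave_on_linorderI)
  fix t a b :: real
  assume t: "0 < t" "t < 1" and ab: "a \<in> {0<..}" "b \<in> {0<..}" "a < b"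
  show "(1 - t) * ball_growth s a + t * ball_growth s b \<le> ball_growth s ((1 - t) *\<^sub>R a + t *\<^sub>R b)"
    using ball_growth_concave[of a b "1 - t" s] t ab by (simp add: add.commute)
qed (rule convex_real_interval)

lemma continuous_on_ball_growth: "continuous_on {0<..} (ball_growth s)"
proof -
  have "continuous_on {0<..} (\<lambda>a. - ball_growth s a)"
    using concave_on_ball_growth unfolding concave_on_def
    by (intro convex_on_continuous open_greaterThan)
  then have "continuous_on {0<..} (\<lambda>a. - (- ball_growth s a))"
    by (rule continuous_on_minus)
  then show ?thesis by simp
qed

text \<open>A nondecreasing concave function that is constant on an interval stays constant to its
  right, whereas the growth rate is unbounded.\<close>

lemma ball_growth_strict_mono:
  assumes "0 < a" "a < b"
  shows "ball_growth s a < ball_growth s b"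
proof (rule ccontr)
  assume "\<not> ball_growth s a < ball_growth s b"
  then have eq: "ball_growth s a = ball_growth s b"
    using ball_growth_mono[OF assms(1) less_imp_le[OF assms(2)], of s] by linarith
  \<comment> \<open>\<open>x\<close> lies so far out that \<open>ln x\<close> exceeds the growth
    rate at \<open>b\<close> by at least 1; \<open>b\<close> is then a convex combination of
    \<open>a\<close> and \<open>x\<close>.\<close>
  define x where "x = max (b + 1) (exp (ball_growth s b + 1))"
  have x: "b < x" unfolding x_def by simp
  have "ln (exp (ball_growth s b + 1)) \<le> ln x" using assms unfolding x_def by (subst ln_le_cancel_iff) auto
  then have gx: "ball_growth s b < ball_growth s x"
    using ball_growth_ge[of x s] x assms by simp
  define t where "t = (b - a) / (x - a)"
  have t: "0 < t" "t < 1" using assms x by (auto simp: t_def)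
  have b: "(1 - (1 - t)) * x + (1 - t) * a = b"
  proof -
    have "t * (x - a) = b - a" using assms x by (simp add: t_def)
    then show ?thesis by (simp add: algebra_simps)
  qed
  have "t * ball_growth s x + (1 - t) * ball_growth s a \<le> ball_growth s b"
    using ball_growth_concave[of a x "1 - t" s] assms x t b by simp
  then have "t * (ball_growth s x - ball_growth s b) \<le> 0"
    unfolding eq by (simp add: algebra_simps)
  with t gx show False by (simp add: mult_le_0_iff)
qed

text \<open>In the Chernoff bound, \<open>t\<close> is fixed first so that the term without
  \<open>a\<close> is below \<open>y / 2\<close>; then \<open>a\<close> makes the other term equal
  to \<open>y / 2\<close>.\<close>

lemma ball_growth_small:
  assumes "0 < y"
  obtains a where "0 < a" "ball_growth s a < y"
proof -
  have "((\<lambda>t. ln ((1 + t) / (1 - t))) \<longlongrightarrow> ln ((1 + 0) / (1 - 0))) (at_right (0::real))"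
    by (intro tendsto_intros) auto
  then have "\<forall>\<^sub>F t in at_right (0::real). ln ((1 + t) / (1 - t)) < y / 2"
    using assms by (intro order_tendstoD(2)) auto
  moreover have "\<forall>\<^sub>F t in at_right (0::real). t \<in> {0<..<1}"
    by (rule eventually_at_right_real) simp
  ultimately have "\<forall>\<^sub>F t in at_right (0::real). ln ((1 + t) / (1 - t)) < y / 2 \<and> t \<in> {0<..<1}"
    by (rule eventually_conj)
  then obtain t :: real where t: "ln ((1 + t) / (1 - t)) < y / 2" "0 < t" "t < 1"
    using eventually_happens[of _ "at_right (0::real)"] by auto
  have lt: "ln t < 0" using t by simp
  define a where "a = y / (2 * - ln t)"
  have a: "0 < a" using assms lt unfolding a_def by (intro divide_pos_pos) auto
  have "- a * ln t = y / 2" using lt by (simp add: a_def field_simps)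
  with ball_growth_le[OF a t(2,3), of s] t(1) have "ball_growth s a < y" by simp
  with a that show thesis by blast
qed

text \<open>The value of \<open>the_inv_into\<close> is meaningful once \<open>1 / l\<close> is
  attained: the intermediate value theorem supplies a preimage and strict monotonicity its
  uniqueness.\<close>

lemma
  assumes "0 < l"
  shows alpha_pos: "0 < alpha s l" and ball_growth_alpha: "ball_growth s (alpha s l) = 1 / l"
proof -
  obtain a where a: "0 < a" "ball_growth s a < 1 / l"
    using ball_growth_small[of "1 / l" s] assms by auto
  \<comment> \<open>The right end of the interval: there the logarithmic lower bound has reached
    \<open>1 / l\<close>.\<close>
  define b where "b = max a (exp (1 / l))"
  have b: "0 < b" "a \<le> b" using a by (auto simp: b_def)
  have "ln (exp (1 / l)) \<le> ln b" using a unfolding b_def by (subst ln_le_cancel_iff) auto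
  then have "1 / l \<le> ball_growth s b" using ball_growth_ge[OF b(1), of s] by simp
  moreover have "continuous_on {a..b} (ball_growth s)"
    using a by (intro continuous_on_subset[OF continuous_on_ball_growth]) auto
  ultimately obtain x where x: "a \<le> x" "ball_growth s x = 1 / l"
    using IVT'[of "ball_growth s" a "1 / l" b] a b by auto
  have inj: "inj_on (ball_growth s) {0<..}"
    using ball_growth_strict_mono by (intro linorder_inj_onI) (auto simp: less_le)
  have "alpha s l = x"
    unfolding alpha_def using x a the_inv_into_f_f[OF inj, of x] by simp
  with x a show "0 < alpha s l" "ball_growth s (alpha s l) = 1 / l" by auto
qed

section \<open>Words in the generators\<close>

text \<open>The powers are multiplied in the order of the list, so that a walk spells the word also
  in a noncommutative group. Lists of unequal length are cut to the shorter one.\<close>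

fun word_prod :: "('a, 'b) monoid_scheme \<Rightarrow> int list \<Rightarrow> 'a list \<Rightarrow> 'a" where
  "word_prod G (i # w) (x # xs) = x [^]\<^bsub>G\<^esub> i \<otimes>\<^bsub>G\<^esub> word_prod G w xs"
| "word_prod G [] xs = \<one>\<^bsub>G\<^esub>"
| "word_prod G w [] = \<one>\<^bsub>G\<^esub>"

definition word_length :: "int list \<Rightarrow> nat" where
  "word_length w = nat (\<Sum>i\<leftarrow>w. \<bar>i\<bar>)"

lemma word_length_Cons [simp]: "word_length (i # w) = nat \<bar>i\<bar> + word_length w"
  by (simp add: word_length_def nat_add_distrib sum_list_abs_nonneg)

lemma word_length_Nil [simp]: "word_length [] = 0"
  by (simp add: word_length_def)

lemma word_length_append [simp]: "word_length (v @ w) = word_length v + word_length w"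
  by (induction v) simp_all

lemma real_word_length: "real (word_length w) = real_of_int (\<Sum>i\<leftarrow>w. \<bar>i\<bar>)"
  using sum_list_abs_nonneg[of w] unfolding word_length_def by (metis of_int_of_nat_eq of_nat_nat)

text \<open>For \<open>A = carrier G\<close> this is the sample space of the generators;
  probabilities are computed as counts in it.\<close>

definition words :: "'a set \<Rightarrow> nat \<Rightarrow> 'a list set" where
  "words A k = {xs. set xs \<subseteq> A \<and> length xs = k}"

lemma finite_words: "finite A \<Longrightarrow> finite (words A k)"
  unfolding words_def by (rule finite_lists_length_eq)

lemma card_words: "finite A \<Longrightarrow> card (words A k) = card A ^ k"
  unfolding words_def by (rule card_lists_length_eq)

text \<open>All coordinates except the \<open>i\<close>-th are frozen: an event that leaves at most
  \<open>c\<close> values for coordinate \<open>i\<close>, whatever the others are, has probability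
  at most \<open>c / card A\<close>.\<close>

lemma card_words_coordinate_le:
  assumes A: "finite A" and i: "i < k"
    and fibre: "\<And>ys zs. ys \<in> words A i \<Longrightarrow> zs \<in> words A (k - Suc i) \<Longrightarrow> card {x \<in> A. P (ys @ x # zs)} \<le> c"
  shows "card {xs \<in> words A k. P xs} \<le> c * card A ^ (k - 1)"
proof -
  let ?I = "words A i \<times> words A (k - Suc i)"
  let ?S = "\<lambda>(ys, zs). (\<lambda>x. ys @ x # zs) ` {x \<in> A. P (ys @ x # zs)}"
  have fin: "finite ?I" using A by (simp add: finite_words)
  have sub: "{xs \<in> words A k. P xs} \<subseteq> (\<Union>p\<in>?I. ?S p)"
  proof
    fix xs assume xs: "xs \<in> {xs \<in> words A k. P xs}"
    then have eq: "xs = take i xs @ xs ! i # drop (Suc i) xs"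
      using i by (simp add: words_def id_take_nth_drop[symmetric])
    have "set (take i xs) \<subseteq> A" "set (drop (Suc i) xs) \<subseteq> A" "xs ! i \<in> A"
      using xs i by (auto simp: words_def dest: in_set_takeD in_set_dropD)
    then have "(take i xs, drop (Suc i) xs) \<in> ?I"
      using xs i by (simp add: words_def)
    moreover have "xs \<in> ?S (take i xs, drop (Suc i) xs)"
      using xs eq \<open>xs ! i \<in> A\<close> by auto
    ultimately show "xs \<in> (\<Union>p\<in>?I. ?S p)" by blast
  qed
  have card_S: "card (?S p) \<le> c" if "p \<in> ?I" for p
  proof -
    obtain ys zs where p: "p = (ys, zs)" by (cases p)
    have "card (?S p) \<le> card {x \<in> A. P (ys @ x # zs)}"
      unfolding p prod.case using A by (intro card_image_le) simp
    also have "\<dots> \<le> c" using that fibre unfolding p by blast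
    finally show ?thesis .
  qed
  have "card {xs \<in> words A k. P xs} \<le> card (\<Union>p\<in>?I. ?S p)"
    using fin A by (intro card_mono[OF _ sub] finite_UN_I) auto
  also have "\<dots> \<le> (\<Sum>p\<in>?I. card (?S p))"
    by (rule card_UN_le[OF fin])
  also have "\<dots> \<le> (\<Sum>p\<in>?I. c)"
    by (rule sum_mono[OF card_S])
  also have "\<dots> = c * (card A ^ i * card A ^ (k - Suc i))"
    using A by (simp add: card_cartesian_product card_words)
  also have "card A ^ i * card A ^ (k - Suc i) = card A ^ (k - 1)"
    using i by (simp flip: power_add)
  finally show ?thesis .
qed

text \<open>Turns probabilities over independent generators into cardinalities of sets of
  lists.\<close>

lemma replicate_pmf_of_set:
  assumes "finite A" "A \<noteq> {}"
  shows "replicate_pmf k (pmf_of_set A) = pmf_of_set (words A k)"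
proof (induction k)
  case 0
  have "words A 0 = {[]}" by (auto simp: words_def)
  then show ?case by (simp add: pmf_of_set_singleton)
next
  case (Suc k)
  have ne: "words A k \<noteq> {}"
  proof -
    obtain a where "a \<in> A" using assms(2) by blast
    then have "replicate k a \<in> words A k" by (auto simp: words_def)
    then show ?thesis by blast
  qed
  have words_Suc: "words A (Suc k) = (\<lambda>(x, xs). x # xs) ` (A \<times> words A k)"
    by (auto simp: words_def length_Suc_conv image_iff)
  have "replicate_pmf (Suc k) (pmf_of_set A) =
      map_pmf (\<lambda>(x, xs). x # xs) (pair_pmf (pmf_of_set A) (replicate_pmf k (pmf_of_set A)))"
    by (simp add: pair_pmf_def map_bind_pmf bind_assoc_pmf bind_return_pmf map_return_pmf)
  also have "\<dots> = map_pmf (\<lambda>(x, xs). x # xs) (pmf_of_set (A \<times> words A k))"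
  proof -
    have "pair_pmf (pmf_of_set A) (pmf_of_set (words A k)) = pmf_of_set (A \<times> words A k)"
    proof (rule pmf_eqI)
      fix p :: "'a \<times> 'a list"
      obtain x xs where p: "p = (x, xs)" by (cases p)
      show "pmf (pair_pmf (pmf_of_set A) (pmf_of_set (words A k))) p = pmf (pmf_of_set (A \<times> words A k)) p"
        unfolding p using assms ne finite_words[OF assms(1), of k]
        by (simp add: pmf_pair indicator_def card_cartesian_product)
    qed
    then show ?thesis unfolding Suc by simp
  qed
  also have "\<dots> = pmf_of_set (words A (Suc k))"
    unfolding words_Suc using assms ne
    by (intro map_pmf_of_set_inj) (auto simp: inj_on_def finite_words)
  finally show ?case .
qed

lemma prob_random_generators:
  assumes "finite (carrier G)" "carrier G \<noteq> {}"
  shows "measure_pmf.prob (random_generators G k) {Z. Q Z} =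
    real (card {xs \<in> words (carrier G) k. Q (mset xs)}) / real (order G) ^ k"
proof -
  have ne: "words (carrier G) k \<noteq> {}"
    using card_words[OF assms(1), of k] assms by (metis card.empty card_0_eq power_eq_0_iff)
  have "measure_pmf.prob (random_generators G k) {Z. Q Z} =
      measure_pmf.prob (pmf_of_set (words (carrier G) k)) {xs. Q (mset xs)}"
    unfolding random_generators_def replicate_pmf_of_set[OF assms] by (simp add: vimage_def)
  also have "\<dots> = real (card (words (carrier G) k \<inter> {xs. Q (mset xs)})) / real (card (words (carrier G) k))"
    by (rule measure_pmf_of_set[OF ne finite_words[OF assms(1)]])
  also have "words (carrier G) k \<inter> {xs. Q (mset xs)} = {xs \<in> words (carrier G) k. Q (mset xs)}"
    by blast
  finally show ?thesis by (simp add: card_words[OF assms(1)] order_def)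
qed

section \<open>Distances and walks in Cayley graphs\<close>

lemma graph_dist_le_iff: "graph_dist E u v \<le> enat R \<longleftrightarrow> (\<exists>r\<le>R. (u, v) \<in> E ^^ r)"
proof -
  \<comment> \<open>The strict form is chosen because \<open>INF_less_iff\<close> produces a witness
    for \<open><\<close>.\<close>
  have "graph_dist E u v \<le> enat R \<longleftrightarrow> graph_dist E u v < enat (Suc R)"
    by (cases "graph_dist E u v") auto
  also have "\<dots> \<longleftrightarrow> (\<exists>r\<in>{r. (u, v) \<in> E ^^ r}. enat r < enat (Suc R))"
    unfolding graph_dist_def by (rule INF_less_iff)
  finally show ?thesis by (auto simp: less_Suc_eq_le)
qed

lemma cayley_diam_le_iff:
  "cayley_diam s G z \<le> enat R \<longleftrightarrow>
    (\<forall>u\<in>carrier G. \<forall>v\<in>carrier G. \<exists>r\<le>R. (u, v) \<in> cayley_adj s G z ^^ r)"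
  unfolding cayley_diam_def graph_diam_def by (simp add: SUP_le_iff graph_dist_le_iff)

context group
begin

lemma word_prod_closed [intro, simp]: "set xs \<subseteq> carrier G \<Longrightarrow> word_prod G w xs \<in> carrier G"
proof (induction xs arbitrary: w)
  case Nil
  then show ?case by (cases w) auto
next
  case (Cons x xs)
  then show ?case by (cases w) auto
qed

lemma word_prod_append:
  assumes "length v = length xs" "set xs \<subseteq> carrier G" "set ys \<subseteq> carrier G"
  shows "word_prod G (v @ w) (xs @ ys) = word_prod G v xs \<otimes> word_prod G w ys"
  using assms by (induction v xs rule: list_induct2) (auto simp: m_assoc)

text \<open>An undirected edge \<open>{g, g \<otimes> x}\<close> can be crossed both ways, and going
  back multiplies by \<open>inv x\<close>. A step is thus right multiplication by
  \<open>x [^] e\<close> with \<open>e = 1\<close>, or also \<open>e = -1\<close> for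
  \<open>Minus\<close>.\<close>

lemma cayley_adj_iff:
  assumes fin: "finite (carrier G)" and z: "set_mset z \<subseteq> carrier G"
  shows "(u, v) \<in> cayley_adj s G z \<longleftrightarrow> u \<in> carrier G \<and>
    (\<exists>x\<in>#z. \<exists>e::int. (e = 1 \<or> s = Minus \<and> e = -1) \<and> v = u \<otimes> x [^] e)"
proof (cases s)
  case Plus
  have "(u, v) \<in># directed_cayley_edges G z \<longleftrightarrow> u \<in> carrier G \<and> (\<exists>x\<in>#z. v = u \<otimes> x)"
    using fin by (auto simp: directed_cayley_edges_def in_Union_mset_iff)
  moreover have "x [^] (1::int) = x" if "x \<in># z" for x
    using that z by auto
  ultimately show ?thesis
    unfolding Plus cayley_adj.simps mem_Collect_eq prod.case by (metis sign.distinct(1))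
next
  case Minus
  have "{u, v} \<in># undirected_cayley_edges G z \<longleftrightarrow>
      (\<exists>x\<in>#z. \<exists>g\<in>carrier G. {u, v} = {g, g \<otimes> x})"
    using fin by (auto simp: undirected_cayley_edges_def in_Union_mset_iff)
  also have "\<dots> \<longleftrightarrow> u \<in> carrier G \<and> (\<exists>x\<in>#z. v = u \<otimes> x \<or> v = u \<otimes> inv x)"
  proof (intro iffI)
    assume "\<exists>x\<in>#z. \<exists>g\<in>carrier G. {u, v} = {g, g \<otimes> x}"
    then obtain x g where x: "x \<in># z" "g \<in> carrier G" "{u, v} = {g, g \<otimes> x}" by blast
    then have xc: "x \<in> carrier G" using z by blast
    from x(3) consider "u = g" "v = g \<otimes> x" | "v = g" "u = g \<otimes> x"
      by (auto simp: doubleton_eq_iff)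
    then show "u \<in> carrier G \<and> (\<exists>x\<in>#z. v = u \<otimes> x \<or> v = u \<otimes> inv x)"
    proof cases
      case 1
      then show ?thesis using x by blast
    next
      case 2
      then have "v = u \<otimes> inv x" using x(2) xc by (simp add: m_assoc)
      moreover have "u \<in> carrier G" using 2 x(2) xc by simp
      ultimately show ?thesis using x(1) by blast
    qed
  next
    assume "u \<in> carrier G \<and> (\<exists>x\<in>#z. v = u \<otimes> x \<or> v = u \<otimes> inv x)"
    then obtain x where u: "u \<in> carrier G" and x: "x \<in># z" and v: "v = u \<otimes> x \<or> v = u \<otimes> inv x" by blast
    have xc: "x \<in> carrier G" using x z by blast
    from v show "\<exists>x\<in>#z. \<exists>g\<in>carrier G. {u, v} = {g, g \<otimes> x}"
    proof
      assume "v = u \<otimes> x"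
      with u x show ?thesis by blast
    next
      assume v: "v = u \<otimes> inv x"
      then have "v \<in> carrier G" "u = v \<otimes> x" using u xc by (auto simp: m_assoc)
      then have "{u, v} = {v, v \<otimes> x}" by blast
      with x \<open>v \<in> carrier G\<close> show ?thesis by blast
    qed
  qed
  also have "\<dots> \<longleftrightarrow> u \<in> carrier G \<and>
    (\<exists>x\<in>#z. \<exists>e::int. (e = 1 \<or> s = Minus \<and> e = -1) \<and> v = u \<otimes> x [^] e)"
  proof -
    have "x [^] (1::int) = x" "x [^] (-1::int) = inv x" if "x \<in># z" for x
      using that z int_pow_neg[of x 1] by auto
    then show ?thesis using Minus by metis
  qed
  finally show ?thesis using Minus by simp
qed

lemma cayley_walk_power:
  assumes fin: "finite (carrier G)" and z: "set_mset z \<subseteq> carrier G"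
    and u: "u \<in> carrier G" and x: "x \<in># z" and e: "e = 1 \<or> s = Minus \<and> e = -1"
  shows "(u, u \<otimes> x [^] (e * int n)) \<in> cayley_adj s G z ^^ n"
proof (induction n)
  case 0
  then show ?case using u by simp
next
  case (Suc n)
  have xc: "x \<in> carrier G" using x z by blast
  have "u \<otimes> x [^] (e * int (Suc n)) = (u \<otimes> x [^] (e * int n)) \<otimes> x [^] e"
    using u xc by (simp add: m_assoc int_pow_mult[symmetric] algebra_simps)
  moreover have "u \<otimes> x [^] (e * int n) \<in> carrier G" using u xc by simp
  ultimately have "(u \<otimes> x [^] (e * int n), u \<otimes> x [^] (e * int (Suc n))) \<in> cayley_adj s G z"
    using cayley_adj_iff[OF fin z] x e by metis
  with Suc show ?case by (rule relpow_Suc_I)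
qed

text \<open>The word is spelled generator by generator, with \<open>nat \<bar>i\<bar>\<close> edges
  for an exponent \<open>i\<close>. Nothing is reordered, so this holds in every group.\<close>

lemma cayley_walk_word:
  assumes fin: "finite (carrier G)" and z: "set_mset z \<subseteq> carrier G"
    and "length w = length xs" "set xs \<subseteq> set_mset z" "s = Plus \<Longrightarrow> \<forall>i\<in>set w. 0 \<le> i" "u \<in> carrier G"
  shows "(u, u \<otimes> word_prod G w xs) \<in> cayley_adj s G z ^^ word_length w"
  using assms(3-)
proof (induction w xs arbitrary: u rule: list_induct2)
  case (Cons i w x xs)
  have x: "x \<in># z" and xc: "x \<in> carrier G" and xsc: "set xs \<subseteq> carrier G"
    using Cons.prems z by auto
  define e :: int where "e = (if 0 \<le> i then 1 else -1)"
  have "e = 1 \<or> s = Minus \<and> e = -1"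
    using Cons.prems(2) unfolding e_def by (cases s) auto
  moreover have "i = e * int (nat \<bar>i\<bar>)"
    unfolding e_def by auto
  ultimately have "(u, u \<otimes> x [^] i) \<in> cayley_adj s G z ^^ nat \<bar>i\<bar>"
    using cayley_walk_power[OF fin z Cons.prems(3) x] by metis
  moreover have "(u \<otimes> x [^] i, u \<otimes> x [^] i \<otimes> word_prod G w xs) \<in> cayley_adj s G z ^^ word_length w"
    using Cons.prems xc by (intro Cons.IH) auto
  ultimately have "(u, u \<otimes> x [^] i \<otimes> word_prod G w xs) \<in> cayley_adj s G z ^^ (nat \<bar>i\<bar> + word_length w)"
    unfolding relpow_add by blast
  then show ?case using Cons.prems(3) xc xsc by (simp add: m_assoc)
qed simp

end

section \<open>Second moment and one extra step\<close>

context group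
begin

lemma order_pos: "finite (carrier G) \<Longrightarrow> 0 < order G"
  unfolding order_def using card_gt_0_iff one_closed by blast

text \<open>Variance bound: an element missed by all words contributes \<open>(0 - |W|)\<^sup>2\<close> to the variance of
  the number of words that represent it.\<close>

lemma card_unreached_le:
  assumes fin: "finite (carrier G)" and W: "finite W" and xs: "set xs \<subseteq> carrier G"
  shows "real (card (carrier G - (\<lambda>w. word_prod G w xs) ` W)) * real (card W) ^ 2 \<le>
    real (order G) * (real (order G) * real (card {p \<in> W \<times> W. word_prod G (fst p) xs = word_prod G (snd p) xs})
      - real (card W) ^ 2)"
proof -
  define n where "n = real (order G)"
  define N where "N = real (card W)"
  define f where "f w = word_prod G w xs" for w
  define c where "c g = real (card {w \<in> W. f w = g})" for g
  have f: "f w \<in> carrier G" for w using xs by (simp add: f_def)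
  have sum_c: "(\<Sum>g\<in>carrier G. c g) = N"
  proof -
    have "card W = (\<Sum>g\<in>carrier G. card {w \<in> W. f w = g})"
      using sum.group[OF W fin, of f "\<lambda>_. 1::nat"] f by (simp add: image_subset_iff)
    then show ?thesis unfolding N_def c_def by simp
  qed
  have sum_sq: "(\<Sum>g\<in>carrier G. c g ^ 2) = real (card {p \<in> W \<times> W. f (fst p) = f (snd p)})"
  proof -
    have "card {p \<in> W \<times> W. f (fst p) = f (snd p)} =
        (\<Sum>g\<in>carrier G. card {p \<in> {p \<in> W \<times> W. f (fst p) = f (snd p)}. f (fst p) = g})"
    proof -
      have "(\<Sum>g\<in>carrier G. \<Sum>p\<in>{p \<in> {p \<in> W \<times> W. f (fst p) = f (snd p)}. f (fst p) = g}. 1::nat) =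
          (\<Sum>p\<in>{p \<in> W \<times> W. f (fst p) = f (snd p)}. 1)"
        using f W fin by (intro sum.group) auto
      then show ?thesis by simp
    qed
    also have "\<dots> = (\<Sum>g\<in>carrier G. card {w \<in> W. f w = g} ^ 2)"
    proof (rule sum.cong[OF refl])
      fix g
      have "{p \<in> {p \<in> W \<times> W. f (fst p) = f (snd p)}. f (fst p) = g} = {w \<in> W. f w = g} \<times> {w \<in> W. f w = g}"
        by auto
      then show "card {p \<in> {p \<in> W \<times> W. f (fst p) = f (snd p)}. f (fst p) = g} = card {w \<in> W. f w = g} ^ 2"
        by (simp add: card_cartesian_product power2_eq_square)
    qed
    finally show ?thesis unfolding c_def by simp
  qed
  have "real (card (carrier G - f ` W)) * N ^ 2 = (\<Sum>g\<in>carrier G - f ` W. (n * c g - N) ^ 2)"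
  proof -
    have "c g = 0" if "g \<in> carrier G - f ` W" for g
    proof -
      have "{w \<in> W. f w = g} = {}" using that by blast
      then show ?thesis unfolding c_def by (simp only: card.empty of_nat_0)
    qed
    then have "(\<Sum>g\<in>carrier G - f ` W. (n * c g - N) ^ 2) = (\<Sum>g\<in>carrier G - f ` W. N ^ 2)"
      by (intro sum.cong) simp_all
    then show ?thesis by simp
  qed
  also have "\<dots> \<le> (\<Sum>g\<in>carrier G. (n * c g - N) ^ 2)"
    using fin by (intro sum_mono2) auto
  also have "\<dots> = (\<Sum>g\<in>carrier G. n ^ 2 * c g ^ 2 - 2 * n * N * c g + N ^ 2)"
    by (simp add: power2_eq_square algebra_simps)
  also have "\<dots> = n ^ 2 * (\<Sum>g\<in>carrier G. c g ^ 2) - 2 * n * N * (\<Sum>g\<in>carrier G. c g) + n * N ^ 2"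
    by (simp add: sum.distrib sum_subtractf sum_distrib_left n_def order_def)
  also have "\<dots> = n * (n * real (card {p \<in> W \<times> W. f (fst p) = f (snd p)}) - N ^ 2)"
    unfolding sum_c sum_sq by (simp add: power2_eq_square algebra_simps)
  finally show ?thesis unfolding n_def N_def f_def .
qed

text \<open>Averages the variance bound over all \<open>xs\<close>. If the values of all pairs of
  words were independent and uniform, the left side of \<open>coll\<close> would be
  \<open>card W ^ 2 * order G ^ k\<close>; \<open>\<eta>\<close> measures the relative excess and
  bounds the expected proportion of missed elements.\<close>

lemma sum_card_unreached_le:
  assumes fin: "finite (carrier G)" and W: "finite W" "W \<noteq> {}"
    and coll: "real (order G) * (\<Sum>v\<in>W. \<Sum>w\<in>W. real (card {xs \<in> words (carrier G) k. word_prod G v xs = word_prod G w xs}))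
      \<le> (1 + \<eta>) * real (card W) ^ 2 * real (order G) ^ k"
  shows "(\<Sum>xs\<in>words (carrier G) k. real (card (carrier G - (\<lambda>w. word_prod G w xs) ` W)))
    \<le> \<eta> * real (order G) * real (order G) ^ k"
proof -
  define n where "n = real (order G)"
  define N where "N = real (card W)"
  define C where "C xs = real (card {p \<in> W \<times> W. word_prod G (fst p) xs = word_prod G (snd p) xs})" for xs
  have N: "0 < N" unfolding N_def using W by (simp add: card_gt_0_iff)
  have "(\<Sum>xs\<in>words (carrier G) k. C xs) =
      (\<Sum>xs\<in>words (carrier G) k. \<Sum>p\<in>W \<times> W. if word_prod G (fst p) xs = word_prod G (snd p) xs then 1 else 0)"
    unfolding C_def using W by (intro sum.cong refl) (simp add: sum.If_cases Int_def case_prod_beta)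
  also have "\<dots> = (\<Sum>p\<in>W \<times> W. \<Sum>xs\<in>words (carrier G) k. if word_prod G (fst p) xs = word_prod G (snd p) xs then 1 else 0)"
    by (rule sum.swap)
  also have "\<dots> = (\<Sum>p\<in>W \<times> W. real (card {xs \<in> words (carrier G) k. word_prod G (fst p) xs = word_prod G (snd p) xs}))"
    using finite_words[OF fin, of k] by (intro sum.cong refl) (simp add: sum.If_cases Int_def)
  also have "\<dots> = (\<Sum>v\<in>W. \<Sum>w\<in>W. real (card {xs \<in> words (carrier G) k. word_prod G v xs = word_prod G w xs}))"
    by (simp add: sum.cartesian_product case_prod_beta)
  finally have sum_C: "n * (\<Sum>xs\<in>words (carrier G) k. C xs) \<le> (1 + \<eta>) * N ^ 2 * n ^ k"
    using coll unfolding n_def N_def by simp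
  have "(\<Sum>xs\<in>words (carrier G) k. real (card (carrier G - (\<lambda>w. word_prod G w xs) ` W))) * N ^ 2
      = (\<Sum>xs\<in>words (carrier G) k. real (card (carrier G - (\<lambda>w. word_prod G w xs) ` W)) * N ^ 2)"
    by (rule sum_distrib_right)
  also have "\<dots> \<le> (\<Sum>xs\<in>words (carrier G) k. n * (n * C xs - N ^ 2))"
    unfolding n_def N_def C_def using fin W by (intro sum_mono card_unreached_le) (auto simp: words_def)
  also have "\<dots> = n * (n * (\<Sum>xs\<in>words (carrier G) k. C xs) - N ^ 2 * n ^ k)"
    using fin by (simp add: sum_subtractf sum_distrib_left card_words n_def order_def algebra_simps)
  also have "\<dots> \<le> n * (\<eta> * N ^ 2 * n ^ k)"
    using sum_C by (intro mult_left_mono) (simp_all add: n_def algebra_simps)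
  also have "\<dots> = (\<eta> * n * n ^ k) * N ^ 2" by simp
  finally show ?thesis using N unfolding n_def N_def by (simp add: mult_le_cancel_right)
qed

text \<open>Union bound over the targets \<open>h\<close>. As
  \<open>y \<mapsto> h \<otimes> inv y\<close> is injective, one uniform \<open>y\<close> misses
  \<open>A\<close> with probability at most \<open>\<delta>\<close>, and the \<open>J\<close>
  entries of \<open>ys\<close> are independent.\<close>

lemma card_no_last_step_le:
  assumes fin: "finite (carrier G)" and A: "A \<subseteq> carrier G" and \<delta>: "real (card (carrier G - A)) \<le> \<delta> * real (order G)"
  shows "real (card {ys \<in> words (carrier G) J. \<exists>h\<in>carrier G. \<forall>y\<in>set ys. h \<otimes> inv y \<notin> A})
    \<le> real (order G) * \<delta> ^ J * real (order G) ^ J"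
proof -
  let ?B = "\<lambda>h. {y \<in> carrier G. h \<otimes> inv y \<notin> A}"
  have card_B: "card (?B h) \<le> card (carrier G - A)" if h: "h \<in> carrier G" for h
  proof (rule card_inj_on_le[where f = "\<lambda>y. h \<otimes> inv y"])
    show "inj_on (\<lambda>y. h \<otimes> inv y) (?B h)"
      using h by (auto simp: inj_on_def) (metis inv_inv)
  qed (use h fin in auto)
  have "{ys \<in> words (carrier G) J. \<exists>h\<in>carrier G. \<forall>y\<in>set ys. h \<otimes> inv y \<notin> A}
      \<subseteq> (\<Union>h\<in>carrier G. words (?B h) J)"
    by (auto simp: words_def)
  then have "card {ys \<in> words (carrier G) J. \<exists>h\<in>carrier G. \<forall>y\<in>set ys. h \<otimes> inv y \<notin> A}
      \<le> card (\<Union>h\<in>carrier G. words (?B h) J)"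
    using fin by (intro card_mono finite_UN_I finite_words) auto
  also have "\<dots> \<le> (\<Sum>h\<in>carrier G. card (words (?B h) J))"
    by (rule card_UN_le[OF fin])
  also have "\<dots> \<le> (\<Sum>h\<in>carrier G. card (carrier G - A) ^ J)"
    using fin by (intro sum_mono) (simp add: card_words card_B power_mono)
  finally have "card {ys \<in> words (carrier G) J. \<exists>h\<in>carrier G. \<forall>y\<in>set ys. h \<otimes> inv y \<notin> A}
      \<le> order G * card (carrier G - A) ^ J"
    by (simp add: order_def)
  then have "real (card {ys \<in> words (carrier G) J. \<exists>h\<in>carrier G. \<forall>y\<in>set ys. h \<otimes> inv y \<notin> A})
      \<le> real (order G) * real (card (carrier G - A)) ^ J"
    unfolding of_nat_power[symmetric] of_nat_mult[symmetric] of_nat_le_iff .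
  also have "\<dots> \<le> real (order G) * (\<delta> * real (order G)) ^ J"
    using \<delta> by (intro mult_left_mono power_mono) auto
  finally show ?thesis by (simp add: power_mult_distrib)
qed

text \<open>Left translation reduces a pair \<open>u\<close>, \<open>v\<close> to the single target
  \<open>inv u \<otimes> v\<close>. The last step multiplies by \<open>y\<close> on the right, so
  the word has to represent \<open>inv u \<otimes> v \<otimes> inv y\<close>.\<close>

lemma cayley_diam_le_Suc:
  assumes fin: "finite (carrier G)" and xs: "xs \<in> words (carrier G) k" and ys: "ys \<in> words (carrier G) J"
    and W: "\<And>w. w \<in> W \<Longrightarrow> length w = k \<and> word_length w \<le> R \<and> (s = Plus \<longrightarrow> (\<forall>i\<in>set w. 0 \<le> i))"
    and step: "\<And>h. h \<in> carrier G \<Longrightarrow> \<exists>y\<in>set ys. h \<otimes> inv y \<in> (\<lambda>w. word_prod G w xs) ` W"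
  shows "cayley_diam s G (mset (xs @ ys)) \<le> enat (Suc R)"
  unfolding cayley_diam_le_iff
proof (intro ballI)
  fix u v assume uv: "u \<in> carrier G" "v \<in> carrier G"
  let ?z = "mset (xs @ ys)"
  have xsc: "set xs \<subseteq> carrier G" and ysc: "set ys \<subseteq> carrier G" and z: "set_mset ?z \<subseteq> carrier G"
    using xs ys by (auto simp: words_def)
  obtain y w where y: "y \<in> set ys" and w: "w \<in> W" "inv u \<otimes> v \<otimes> inv y = word_prod G w xs"
    using step[of "inv u \<otimes> v"] uv by auto
  have yc: "y \<in> carrier G" using y ysc by blast
  have len: "length w = length xs" using W[OF w(1)] xs by (simp add: words_def)
  have walk: "(u, u \<otimes> word_prod G w xs) \<in> cayley_adj s G ?z ^^ word_length w"
    using W[OF w(1)] by (intro cayley_walk_word[OF fin z len]) (auto simp: uv)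
  have "u \<otimes> word_prod G w xs \<otimes> y [^] (1::int) = v"
  proof -
    have "u \<otimes> word_prod G w xs \<otimes> y = u \<otimes> (inv u \<otimes> v \<otimes> inv y) \<otimes> y"
      unfolding w(2) ..
    also have "\<dots> = v" using uv yc by (simp add: m_assoc) (simp flip: m_assoc)
    finally show ?thesis using yc by simp
  qed
  then have "(u \<otimes> word_prod G w xs, v) \<in> cayley_adj s G ?z"
    unfolding cayley_adj_iff[OF fin z] using y uv xsc
    by (intro conjI bexI[of _ y] exI[of _ 1]) auto
  with walk have "(u, v) \<in> cayley_adj s G ?z ^^ Suc (word_length w)"
    by (rule relpow_Suc_I)
  then show "\<exists>r\<le>Suc R. (u, v) \<in> cayley_adj s G ?z ^^ r"
    using W[OF w(1)] by (intro exI[of _ "Suc (word_length w)"]) simp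
qed

text \<open>Two independent rounds: the first \<open>k\<close> generators decide which elements are
  values of words, the other \<open>J\<close> supply the last step.\<close>

proposition prob_cayley_diam_le:
  assumes fin: "finite (carrier G)" and Wfin: "finite W" "W \<noteq> {}"
    and W: "\<And>w. w \<in> W \<Longrightarrow> length w = k \<and> word_length w \<le> R \<and> (s = Plus \<longrightarrow> (\<forall>i\<in>set w. 0 \<le> i))"
    and \<eta>: "0 < \<eta>"
    and coll: "real (order G) * (\<Sum>v\<in>W. \<Sum>w\<in>W. real (card {xs \<in> words (carrier G) k. word_prod G v xs = word_prod G w xs}))
      \<le> (1 + \<eta>) * real (card W) ^ 2 * real (order G) ^ k"
  shows "1 - (sqrt \<eta> + real (order G) * sqrt \<eta> ^ J)
    \<le> measure_pmf.prob (random_generators G (k + J)) {Z. cayley_diam s G Z \<le> enat (Suc R)}"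
proof -
  define n where "n = real (order G)"
  \<comment> \<open>Markov's inequality: the missed proportion has mean at most
    \<open>\<eta> = \<delta> * \<delta>\<close>, so it exceeds \<open>\<delta>\<close> with
    probability at most \<open>\<delta>\<close>.\<close>
  define \<delta> where "\<delta> = sqrt \<eta>"
  have n: "0 < n" unfolding n_def using order_pos[OF fin] by simp
  have \<delta>: "0 < \<delta>" "\<delta> * \<delta> = \<eta>" using \<eta> by (simp_all add: \<delta>_def)
  define A where "A xs = (\<lambda>w. word_prod G w xs) ` W" for xs
  define B where "B = {xs \<in> words (carrier G) k. \<delta> * n < real (card (carrier G - A xs))}"
  define bad where "bad xs = {ys \<in> words (carrier G) J. \<exists>h\<in>carrier G. \<forall>y\<in>set ys. h \<otimes> inv y \<notin> A xs}" for xs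
  let ?\<Omega> = "words (carrier G)"
  let ?Bad = "{zs \<in> ?\<Omega> (k + J). \<not> cayley_diam s G (mset zs) \<le> enat (Suc R)}"
  have fin\<Omega>: "finite (?\<Omega> m)" for m by (rule finite_words[OF fin])
  have card\<Omega>: "real (card (?\<Omega> m)) = n ^ m" for m by (simp add: card_words[OF fin] n_def order_def)
  have "real (card B) * (\<delta> * n) = (\<Sum>xs\<in>B. \<delta> * n)" by simp
  also have "\<dots> \<le> (\<Sum>xs\<in>B. real (card (carrier G - A xs)))"
    by (intro sum_mono) (simp add: B_def)
  also have "\<dots> \<le> (\<Sum>xs\<in>?\<Omega> k. real (card (carrier G - A xs)))"
    using fin\<Omega> by (intro sum_mono2) (auto simp: B_def)
  also have "\<dots> \<le> \<eta> * n * n ^ k"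
    unfolding A_def n_def by (rule sum_card_unreached_le[OF fin Wfin coll])
  also have "\<dots> = (\<delta> * n ^ k) * (\<delta> * n)" unfolding \<delta>(2)[symmetric] by simp
  finally have card_B: "real (card B) \<le> \<delta> * n ^ k"
    using \<delta>(1) n by (simp add: mult_le_cancel_right)
  have bad_le: "real (card (bad xs)) \<le> n * \<delta> ^ J * n ^ J" if "xs \<in> ?\<Omega> k" "xs \<notin> B" for xs
    unfolding bad_def n_def
  proof (rule card_no_last_step_le[OF fin])
    show "A xs \<subseteq> carrier G" using that by (auto simp: A_def words_def)
    show "real (card (carrier G - A xs)) \<le> \<delta> * real (order G)"
      using that unfolding B_def n_def by simp
  qed
  have "?Bad \<subseteq> (\<lambda>(xs, ys). xs @ ys) ` (SIGMA xs:?\<Omega> k. bad xs)"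
  proof
    fix zs assume zs: "zs \<in> ?Bad"
    define xs ys where "xs = take k zs" and "ys = drop k zs"
    have eq: "zs = xs @ ys" by (simp add: xs_def ys_def)
    have mem: "xs \<in> ?\<Omega> k" "ys \<in> ?\<Omega> J"
      using zs by (auto simp: xs_def ys_def words_def dest: in_set_takeD in_set_dropD)
    have "ys \<in> bad xs"
    proof (rule ccontr)
      assume "ys \<notin> bad xs"
      then have "\<And>h. h \<in> carrier G \<Longrightarrow> \<exists>y\<in>set ys. h \<otimes> inv y \<in> (\<lambda>w. word_prod G w xs) ` W"
        using mem(2) unfolding bad_def A_def by blast
      with cayley_diam_le_Suc[OF fin mem W] zs eq show False by blast
    qed
    with mem(1) eq show "zs \<in> (\<lambda>(xs, ys). xs @ ys) ` (SIGMA xs:?\<Omega> k. bad xs)" by auto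
  qed
  then have "card ?Bad \<le> card (SIGMA xs:?\<Omega> k. bad xs)"
    using fin\<Omega> by (intro surj_card_le finite_SigmaI) (auto simp: bad_def)
  also have "\<dots> = (\<Sum>xs\<in>?\<Omega> k. card (bad xs))"
    using fin\<Omega> by (intro card_SigmaI) (auto simp: bad_def)
  finally have "real (card ?Bad) \<le> (\<Sum>xs\<in>?\<Omega> k. real (card (bad xs)))"
    unfolding of_nat_sum[symmetric] of_nat_le_iff .
  \<comment> \<open>For \<open>xs\<close> in \<open>B\<close> the second round is given up and every
    \<open>ys\<close> is counted as bad.\<close>
  also have "\<dots> \<le> (\<Sum>xs\<in>?\<Omega> k. (if xs \<in> B then n ^ J else 0) + n * \<delta> ^ J * n ^ J)"
  proof (rule sum_mono)
    fix xs assume xs: "xs \<in> ?\<Omega> k"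
    have "card (bad xs) \<le> card (?\<Omega> J)"
      using fin\<Omega> by (intro card_mono) (auto simp: bad_def)
    then have "real (card (bad xs)) \<le> n ^ J" unfolding card\<Omega>[symmetric] by simp
    moreover have "0 \<le> n * \<delta> ^ J * n ^ J" using n \<delta>(1) by simp
    ultimately show "real (card (bad xs)) \<le> (if xs \<in> B then n ^ J else 0) + n * \<delta> ^ J * n ^ J"
      using bad_le[OF xs] by auto
  qed
  also have "\<dots> = real (card B) * n ^ J + n ^ k * (n * \<delta> ^ J * n ^ J)"
  proof -
    have "?\<Omega> k \<inter> B = B" by (auto simp: B_def)
    then have "(\<Sum>xs\<in>?\<Omega> k. if xs \<in> B then n ^ J else 0) = real (card B) * n ^ J"
      using fin\<Omega>[of k] by (simp add: sum.If_cases)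
    then show ?thesis by (simp add: sum.distrib card\<Omega>)
  qed
  also have "\<dots> \<le> (\<delta> * n ^ k) * n ^ J + n ^ k * (n * \<delta> ^ J * n ^ J)"
    using card_B n by (intro add_right_mono mult_right_mono) auto
  also have "\<dots> = (\<delta> + n * \<delta> ^ J) * n ^ (k + J)"
    by (simp add: power_add algebra_simps)
  finally have Bad: "real (card ?Bad) \<le> (\<delta> + n * \<delta> ^ J) * n ^ (k + J)" .
  let ?Good = "{zs \<in> ?\<Omega> (k + J). cayley_diam s G (mset zs) \<le> enat (Suc R)}"
  have "?\<Omega> (k + J) = ?Good \<union> ?Bad" by blast
  then have "real (card (?\<Omega> (k + J))) \<le> real (card ?Good) + real (card ?Bad)"
    using card_Un_le[of ?Good ?Bad] by simp
  then have "n ^ (k + J) \<le> real (card ?Good) + (\<delta> + n * \<delta> ^ J) * n ^ (k + J)"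
    unfolding card\<Omega> using Bad by linarith
  then have "1 - (\<delta> + n * \<delta> ^ J) \<le> real (card ?Good) / n ^ (k + J)"
    using n by (simp add: pos_le_divide_eq left_diff_distrib)
  moreover have "carrier G \<noteq> {}" using one_closed by blast
  ultimately show ?thesis
    using prob_random_generators[OF fin, of "k + J" "\<lambda>Z. cayley_diam s G Z \<le> enat (Suc R)"]
    unfolding \<delta>_def n_def by simp
qed

end

section \<open>Collisions of words\<close>

lemma (in group) word_prod_split:
  assumes "i < length w" "length ys = i" "x \<in> carrier G" "set ys \<subseteq> carrier G" "set zs \<subseteq> carrier G"
  shows "word_prod G w (ys @ x # zs) =
    word_prod G (take i w) ys \<otimes> (x [^] (w ! i) \<otimes> word_prod G (drop (Suc i) w) zs)"
proof -
  have "word_prod G (take i w @ w ! i # drop (Suc i) w) (ys @ x # zs) =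
      word_prod G (take i w) ys \<otimes> (x [^] (w ! i) \<otimes> word_prod G (drop (Suc i) w) zs)"
    using assms by (subst word_prod_append) auto
  then show ?thesis using id_take_nth_drop[OF assms(1)] by simp
qed

text \<open>On the side of \<open>w\<close> the \<open>i\<close>-th generator has exponent 0 and
  disappears, so once the other generators are fixed, cancellation leaves at most one solution
  \<open>x\<close>, in any group.\<close>

lemma (in group) card_collision_binary_le:
  assumes fin: "finite (carrier G)" and len: "length v = k" "length w = k" and i: "i < k" "v ! i = 1" "w ! i = 0"
  shows "card {xs \<in> words (carrier G) k. word_prod G v xs = word_prod G w xs} \<le> order G ^ (k - 1)"
proof -
  have "card {xs \<in> words (carrier G) k. word_prod G v xs = word_prod G w xs} \<le> 1 * card (carrier G) ^ (k - 1)"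
  proof (rule card_words_coordinate_le[OF fin i(1)])
    fix ys zs assume yz: "ys \<in> words (carrier G) i" "zs \<in> words (carrier G) (k - Suc i)"
    then have ys: "length ys = i" "set ys \<subseteq> carrier G" and zs: "set zs \<subseteq> carrier G" by (auto simp: words_def)
    have iv: "i < length v" "i < length w" using len i by auto
    have "x = y" if x: "x \<in> carrier G" "word_prod G v (ys @ x # zs) = word_prod G w (ys @ x # zs)"
      and y: "y \<in> carrier G" "word_prod G v (ys @ y # zs) = word_prod G w (ys @ y # zs)" for x y
    proof -
      let ?p = "word_prod G (take i v) ys" and ?q = "word_prod G (drop (Suc i) v) zs"
      have "?p \<otimes> (x \<otimes> ?q) = ?p \<otimes> (y \<otimes> ?q)"
        using x y i(2,3) ys zs word_prod_split[OF iv(1) ys(1)] word_prod_split[OF iv(2) ys(1)]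
        by (simp add: int_pow_1)
      then show ?thesis using x y ys zs by simp
    qed
    then show "card {x \<in> carrier G. word_prod G v (ys @ x # zs) = word_prod G w (ys @ x # zs)} \<le> 1"
      using fin by (subst One_nat_def, subst card_le_Suc0_iff_eq) auto
  qed
  then show ?thesis by (simp add: order_def)
qed

section \<open>Torsion and collisions in Abelian groups\<close>

context comm_group
begin

lemma word_prod_add:
  assumes "length v = length w" "length w = length xs" "set xs \<subseteq> carrier G"
  shows "word_prod G (map2 (+) v w) xs = word_prod G v xs \<otimes> word_prod G w xs"
  using assms by (induction v w xs rule: list_induct3) (auto simp: int_pow_mult m_ac)

lemma word_prod_scale:
  assumes "length w = length xs" "set xs \<subseteq> carrier G"
  shows "word_prod G (map (\<lambda>i. i * r) w) xs = word_prod G w xs [^] r"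
  using assms by (induction w xs rule: list_induct2) (auto simp: int_pow_pow int_pow_distrib int_pow_one)

lemma word_prod_update:
  assumes "length w = length xs" "set xs \<subseteq> carrier G" "i < length xs"
  shows "word_prod G (w[i := w ! i + e]) xs = word_prod G w xs \<otimes> xs ! i [^] e"
  using assms
proof (induction w xs arbitrary: i rule: list_induct2)
  case (Cons j w x xs)
  show ?case
  proof (cases i)
    case 0
    then show ?thesis using Cons.prems by (auto simp: int_pow_mult m_ac)
  next
    case (Suc l)
    then have "xs ! l \<in> carrier G" using Cons.prems nth_mem[of l xs] by auto
    then show ?thesis using Suc Cons by (auto simp: m_assoc)
  qed
qed simp

lemma word_prod_replicate_0: "set xs \<subseteq> carrier G \<Longrightarrow> word_prod G (replicate (length xs) 0) xs = \<one>"
  by (induction xs) auto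

text \<open>In an Abelian group any product of generators can be sorted, so exponent vectors
  describe the generated subgroup.\<close>

lemma generate_eq_word_prod:
  assumes xs: "set xs \<subseteq> carrier G" and g: "g \<in> generate G (set xs)"
  shows "\<exists>w. length w = length xs \<and> word_prod G w xs = g"
  using g
proof (induction g rule: generate.induct)
  case one
  show ?case using word_prod_replicate_0[OF xs] by (intro exI[of _ "replicate (length xs) 0"]) simp
next
  case (incl h)
  then obtain i where i: "i < length xs" "xs ! i = h" by (auto simp: in_set_conv_nth)
  then show ?case
    using word_prod_update[OF _ xs i(1), of "replicate (length xs) 0" 1] word_prod_replicate_0[OF xs] xs incl
    by (intro exI[of _ "(replicate (length xs) 0)[i := 1]"]) auto
next
  case (inv h)
  then obtain i where i: "i < length xs" "xs ! i = h" by (auto simp: in_set_conv_nth)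
  have h: "h \<in> carrier G" using xs inv by blast
  then have "h [^] (-1::int) = inv h" using int_pow_neg[of h 1] by simp
  then show ?case
    using word_prod_update[OF _ xs i(1), of "replicate (length xs) 0" "-1"] word_prod_replicate_0[OF xs] h i
    by (intro exI[of _ "(replicate (length xs) 0)[i := -1]"]) auto
next
  case (eng g h)
  then obtain v w where "length v = length xs" "word_prod G v xs = g" "length w = length xs" "word_prod G w xs = h"
    by blast
  then show ?case using word_prod_add[of v w xs] xs
    by (intro exI[of _ "map2 (+) v w"]) simp
qed

text \<open>Compares kernel and image of \<open>x \<mapsto> x [^] r\<close>. The product of their
  sizes is at most \<open>card (carrier G)\<close>, while modulo \<open>r\<close>-th powers the
  exponents of the generators matter only modulo \<open>r\<close>, so the image has index at most
  \<open>r ^ length xs\<close>.\<close>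

lemma card_torsion_le:
  fixes r :: nat
  assumes fin: "finite (carrier G)" and xs: "set xs \<subseteq> carrier G" "generate G (set xs) = carrier G" and r: "0 < r"
  shows "card {x \<in> carrier G. x [^] r = \<one>} \<le> r ^ length xs"
proof -
  let ?T = "{x \<in> carrier G. x [^] r = \<one>}"
  let ?H = "(\<lambda>x. x [^] r) ` carrier G"
  let ?V = "words {0..<int r} (length xs)"
  have "carrier G \<subseteq> (\<lambda>(v, h). word_prod G v xs \<otimes> h) ` (?V \<times> ?H)"
  proof
    fix g assume "g \<in> carrier G"
    then obtain w where w: "length w = length xs" "word_prod G w xs = g"
      using generate_eq_word_prod[OF xs(1)] xs(2) by blast
    let ?v = "map (\<lambda>i. i mod int r) w" and ?u = "map (\<lambda>i. i div int r) w"
    have "w = map2 (+) ?v (map (\<lambda>i. i * int r) ?u)"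
      by (rule nth_equalityI) auto
    then have "g = word_prod G ?v xs \<otimes> word_prod G (map (\<lambda>i. i * int r) ?u) xs"
      using w word_prod_add[of ?v "map (\<lambda>i. i * int r) ?u" xs] xs(1) by simp
    also have "word_prod G (map (\<lambda>i. i * int r) ?u) xs = word_prod G ?u xs [^] r"
      using word_prod_scale[of ?u xs "int r"] w xs(1) by (simp add: int_pow_int)
    finally have "g = word_prod G ?v xs \<otimes> (word_prod G ?u xs [^] r)" .
    moreover have "?v \<in> ?V" using r w(1) by (auto simp: words_def)
    moreover have "word_prod G ?u xs \<in> carrier G" using xs(1) by simp
    ultimately show "g \<in> (\<lambda>(v, h). word_prod G v xs \<otimes> h) ` (?V \<times> ?H)"
      by (auto simp: image_iff)
  qed
  then have "card (carrier G) \<le> card (?V \<times> ?H)"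
    using fin by (intro surj_card_le) (auto simp: finite_words)
  then have upper: "card (carrier G) \<le> r ^ length xs * card ?H"
    by (simp add: card_cartesian_product card_words)
  have "card (?T \<times> ?H) \<le> card (carrier G)"
  proof (rule card_inj_on_le)
    \<comment> \<open>One \<open>r\<close>-th root is chosen for each \<open>h\<close>: the
      \<open>r\<close>-th power of \<open>t \<otimes> ?root h\<close> gives back \<open>h\<close>,
      and cancelling the root then gives back \<open>t\<close>.\<close>
    let ?root = "inv_into (carrier G) (\<lambda>x. x [^] r)"
    have root: "?root h \<in> carrier G" "?root h [^] r = h" if "h \<in> ?H" for h
      using that by (rule inv_into_into, rule f_inv_into_f)
    show "inj_on (\<lambda>(t, h). t \<otimes> ?root h) (?T \<times> ?H)"
    proof (rule inj_onI, clarsimp simp del: image_iff)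
      fix t x t' y
      assume t: "t \<in> carrier G" "t [^] r = \<one>" and t': "t' \<in> carrier G" "t' [^] r = \<one>"
        and xy: "x \<in> carrier G" "y \<in> carrier G"
        and eq: "t \<otimes> ?root (x [^] r) = t' \<otimes> ?root (y [^] r)"
      have hx: "x [^] r \<in> ?H" and hy: "y [^] r \<in> ?H" using xy by auto
      have "(t \<otimes> ?root (x [^] r)) [^] r = x [^] r"
        using t root[OF hx] xy by (simp add: nat_pow_distrib)
      moreover have "(t' \<otimes> ?root (y [^] r)) [^] r = y [^] r"
        using t' root[OF hy] xy by (simp add: nat_pow_distrib)
      ultimately have h: "x [^] r = y [^] r" using eq by simp
      with eq t t' root[OF hy] show "t = t' \<and> x [^] r = y [^] r" by simp
    qed
    show "(\<lambda>(t, h). t \<otimes> ?root h) ` (?T \<times> ?H) \<subseteq> carrier G"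
      using root(1) by auto
  qed (rule fin)
  then have "card ?T * card ?H \<le> r ^ length xs * card ?H"
    unfolding card_cartesian_product using upper by (rule order_trans)
  moreover have "0 < card ?H" using fin one_closed by (auto simp: card_gt_0_iff)
  ultimately show ?thesis unfolding mult_le_cancel2 by blast
qed

lemma card_torsion_le_min_generators:
  fixes e :: int
  assumes fin: "finite (carrier G)" and e: "e \<noteq> 0"
  shows "card {x \<in> carrier G. x [^] e = \<one>} \<le> nat \<bar>e\<bar> ^ min_generators G"
proof -
  have "generate G (carrier G) = carrier G"
    using generate_incl[of "carrier G"] generate.incl[of _ "carrier G" G] by blast
  then have "\<exists>n S. S \<subseteq> carrier G \<and> finite S \<and> card S = n \<and> generate G S = carrier G"
    using fin by blast
  from LeastI_ex[OF this] obtain S where S: "S \<subseteq> carrier G" "finite S" "card S = min_generators G"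
      "generate G S = carrier G"
    unfolding min_generators_def by blast
  obtain xs where xs: "set xs = S" "distinct xs" using finite_distinct_list[OF S(2)] by blast
  have "length xs = min_generators G" using xs S(3) distinct_card by fastforce
  moreover have "x [^] e = \<one> \<longleftrightarrow> x [^] (nat \<bar>e\<bar>) = \<one>" if x: "x \<in> carrier G" for x
  proof (cases "0 \<le> e")
    case True
    then show ?thesis using int_pow_int[of G x "nat \<bar>e\<bar>"] by simp
  next
    case False
    then have "x [^] e = inv (x [^] (nat \<bar>e\<bar>))"
      using int_pow_neg_int[OF x, of "nat \<bar>e\<bar>"] by simp
    then show ?thesis using x by (simp add: inv_eq_1_iff)
  qed
  then have "{x \<in> carrier G. x [^] e = \<one>} = {x \<in> carrier G. x [^] (nat \<bar>e\<bar>) = \<one>}"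
    by blast
  ultimately show ?thesis
    using card_torsion_le[OF fin, of xs "nat \<bar>e\<bar>"] S xs e by simp
qed

text \<open>With the other generators fixed, the equation says that
  \<open>x [^] (v ! i - w ! i)\<close> has a prescribed value; its solutions are empty or lie in one
  coset of the torsion of that exponent.\<close>

lemma card_collision_le:
  assumes fin: "finite (carrier G)" and len: "length v = k" "length w = k" and i: "i < k"
    and c: "card {x \<in> carrier G. x [^] (v ! i - w ! i) = \<one>} \<le> c"
  shows "card {xs \<in> words (carrier G) k. word_prod G v xs = word_prod G w xs} \<le> c * order G ^ (k - 1)"
  unfolding order_def
proof (rule card_words_coordinate_le[OF fin i])
  fix ys zs assume yz: "ys \<in> words (carrier G) i" "zs \<in> words (carrier G) (k - Suc i)"
  then have ys: "length ys = i" "set ys \<subseteq> carrier G" and zs: "set zs \<subseteq> carrier G" by (auto simp: words_def)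
  have iv: "i < length v" "i < length w" using len i by auto
  let ?e = "v ! i - w ! i"
  let ?p = "word_prod G (take i v) ys" and ?q = "word_prod G (drop (Suc i) v) zs"
  let ?p' = "word_prod G (take i w) ys" and ?q' = "word_prod G (drop (Suc i) w) zs"
  let ?S = "{x \<in> carrier G. word_prod G v (ys @ x # zs) = word_prod G w (ys @ x # zs)}"
  have pow: "x [^] ?e = inv (?p \<otimes> ?q) \<otimes> (?p' \<otimes> ?q')" if "x \<in> ?S" for x
  proof -
    have x: "x \<in> carrier G" using that by blast
    have "word_prod G v (ys @ x # zs) = word_prod G w (ys @ x # zs)" using that by blast
    then have "?p \<otimes> (x [^] (v ! i) \<otimes> ?q) = ?p' \<otimes> (x [^] (w ! i) \<otimes> ?q')"
      unfolding word_prod_split[OF iv(1) ys(1) x ys(2) zs] word_prod_split[OF iv(2) ys(1) x ys(2) zs] .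
    moreover have "x [^] (v ! i) = x [^] (w ! i) \<otimes> x [^] ?e"
      using x by (simp add: int_pow_mult[symmetric])
    ultimately have "x [^] (w ! i) \<otimes> ((?p \<otimes> ?q) \<otimes> x [^] ?e) = x [^] (w ! i) \<otimes> (?p' \<otimes> ?q')"
      using x ys zs by (simp add: m_ac)
    then have "(?p \<otimes> ?q) \<otimes> x [^] ?e = ?p' \<otimes> ?q'"
      using x ys zs by simp
    then show ?thesis using x ys zs by (intro inv_solve_left[THEN iffD2]) auto
  qed
  show "card ?S \<le> c"
  proof (cases "?S = {}")
    case False
    then obtain y where y: "y \<in> ?S" by blast
    have "card ?S \<le> card {x \<in> carrier G. x [^] ?e = \<one>}"
    proof (rule card_inj_on_le[where f = "\<lambda>x. x \<otimes> inv y"])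
      show "inj_on (\<lambda>x. x \<otimes> inv y) ?S" using y by (auto simp: inj_on_def)
      show "(\<lambda>x. x \<otimes> inv y) ` ?S \<subseteq> {x \<in> carrier G. x [^] ?e = \<one>}"
      proof
        fix t assume "t \<in> (\<lambda>x. x \<otimes> inv y) ` ?S"
        then obtain x where x: "x \<in> ?S" "t = x \<otimes> inv y" by blast
        have "t [^] ?e = x [^] ?e \<otimes> inv (y [^] ?e)"
          using x y by (simp add: int_pow_distrib int_pow_inv)
        also have "\<dots> = \<one>"
          unfolding pow[OF x(1)] pow[OF y] using ys zs by simp
        finally show "t \<in> {x \<in> carrier G. x [^] ?e = \<one>}" using x y by simp
      qed
    qed (use fin in simp)
    with c show ?thesis by (rule order_trans[rotated])
  next
    case True
    show ?thesis unfolding True by simp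
  qed
qed

end

section \<open>Diameter bounds from the two families of words\<close>

lemma (in group) prob_cayley_diam_le_binomial:
  assumes fin: "finite (carrier G)" and R: "R \<le> k"
    and \<eta>: "real (order G) / real (k choose R) = \<eta>"
  shows "1 - (sqrt \<eta> + real (order G) * sqrt \<eta> ^ J)
    \<le> measure_pmf.prob (random_generators G (k + J)) {Z. cayley_diam s G Z \<le> enat (Suc R)}"
proof -
  define f where "f S = map (\<lambda>i. if i \<in> S then 1 else 0 :: int) [0..<k]" for S
  \<comment> \<open>Sets of equal size are never strictly nested, so for distinct \<open>S\<close>
    and \<open>T\<close> some index lies in \<open>S\<close> but not in \<open>T\<close>. There the
    exponents are 1 and 0, as \<open>card_collision_binary_le\<close> requires.\<close>
  define \<S> where "\<S> = {S. S \<subseteq> {..<k} \<and> card S = R}"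
  have fin\<S>: "finite \<S>" unfolding \<S>_def by (rule finite_subset[of _ "Pow {..<k}"]) auto
  have card\<S>: "card \<S> = k choose R" unfolding \<S>_def by (simp add: n_subsets)
  have pos: "0 < card \<S>" using R by (simp add: card\<S>)
  have nth_f: "f S ! i = (if i \<in> S then 1 else 0)" if "i < k" for S i
    using that by (simp add: f_def)
  have inj: "inj_on f \<S>"
  proof (rule inj_onI)
    fix S T assume ST: "S \<in> \<S>" "T \<in> \<S>" "f S = f T"
    have "i \<in> S \<longleftrightarrow> i \<in> T" if "i < k" for i
      using nth_f[OF that, of S] nth_f[OF that, of T] ST(3) by (auto split: if_splits)
    with ST(1,2) show "S = T" unfolding \<S>_def by blast
  qed
  let ?n = "real (order G)"
  have n: "0 < ?n" using order_pos[OF fin] by simp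
  show ?thesis
  proof (rule prob_cayley_diam_le[OF fin])
    show "finite (f ` \<S>)" "f ` \<S> \<noteq> {}" using fin\<S> pos by auto
    show "0 < \<eta>" unfolding \<eta>[symmetric] using n pos by (simp add: card\<S>)
  next
    fix w assume "w \<in> f ` \<S>"
    then obtain S where S: "S \<in> \<S>" "w = f S" by blast
    have "(\<Sum>i\<leftarrow>w. \<bar>i\<bar>) = (\<Sum>i<k. if i \<in> S then 1 else 0)"
      unfolding S(2) f_def
      by (simp add: o_def interv_sum_list_conv_sum_set_nat atLeast0LessThan cong: if_cong)
    also have "\<dots> = int (card S)"
    proof -
      have "{..<k} \<inter> S = S" using S(1) unfolding \<S>_def by blast
      then show ?thesis by (simp add: sum.If_cases)
    qed
    finally have "word_length w = R" using S(1) unfolding word_length_def \<S>_def by simp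
    then show "length w = k \<and> word_length w \<le> R \<and> (s = Plus \<longrightarrow> (\<forall>i\<in>set w. 0 \<le> i))"
      unfolding S(2) by (auto simp: f_def)
  next
    let ?c = "\<lambda>v w. real (card {xs \<in> words (carrier G) k. word_prod G v xs = word_prod G w xs})"
    \<comment> \<open>Only the diagonal deviates from independence; it adds \<open>order G\<close>
      for each word, whence \<open>\<eta> = order G / card \<S>\<close>.\<close>
    have coll: "?n * ?c (f S) (f T) \<le> ?n ^ k * (1 + (if S = T then ?n else 0))"
      if ST: "S \<in> \<S>" "T \<in> \<S>" for S T
    proof (cases "S = T")
      case True
      have "?n * ?c (f S) (f T) = ?n * ?n ^ k" using True by (simp add: card_words[OF fin] order_def)
      also have "\<dots> \<le> ?n ^ k * (1 + ?n)" by (simp add: distrib_left)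
      finally show ?thesis using True by simp
    next
      case False
      have "\<not> S \<subseteq> T"
      proof
        assume "S \<subseteq> T"
        moreover have "finite T" using ST(2) finite_subset[of T "{..<k}"] unfolding \<S>_def by auto
        ultimately have "S = T" using ST card_subset_eq[of T S] unfolding \<S>_def by auto
        with False show False by contradiction
      qed
      then obtain i where i: "i \<in> S" "i \<notin> T" by blast
      then have ik: "i < k" using ST unfolding \<S>_def by blast
      have "card {xs \<in> words (carrier G) k. word_prod G (f S) xs = word_prod G (f T) xs} \<le> order G ^ (k - 1)"
        using nth_f[OF ik] i by (intro card_collision_binary_le[OF fin _ _ ik]) (auto simp: f_def)
      then have "?c (f S) (f T) \<le> ?n ^ (k - 1)"
        unfolding of_nat_power[symmetric] of_nat_le_iff .
      then have "?n * ?c (f S) (f T) \<le> ?n * ?n ^ (k - 1)" using n by simp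
      also have "?n * ?n ^ (k - 1) = ?n ^ k" using ik by (cases k) auto
      finally show ?thesis using False by simp
    qed
    have "?n * (\<Sum>v\<in>f ` \<S>. \<Sum>w\<in>f ` \<S>. ?c v w) = (\<Sum>S\<in>\<S>. \<Sum>T\<in>\<S>. ?n * ?c (f S) (f T))"
      by (simp add: sum.reindex[OF inj] sum_distrib_left o_def)
    also have "\<dots> \<le> (\<Sum>S\<in>\<S>. \<Sum>T\<in>\<S>. ?n ^ k * (1 + (if S = T then ?n else 0)))"
      by (intro sum_mono coll)
    also have "\<dots> = ?n ^ k * (real (card \<S>) ^ 2 + real (card \<S>) * ?n)"
    proof -
      have "(\<Sum>T\<in>\<S>. 1 + (if S = T then ?n else 0)) = real (card \<S>) + ?n" if "S \<in> \<S>" for S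
        using that fin\<S> by (simp add: sum.distrib sum.delta)
      then have "(\<Sum>S\<in>\<S>. \<Sum>T\<in>\<S>. ?n ^ k * (1 + (if S = T then ?n else 0))) =
          (\<Sum>S\<in>\<S>. ?n ^ k * (real (card \<S>) + ?n))"
        by (intro sum.cong) (simp_all flip: sum_distrib_left)
      then show ?thesis by (simp add: power2_eq_square algebra_simps)
    qed
    also have "\<dots> = (1 + \<eta>) * real (card (f ` \<S>)) ^ 2 * ?n ^ k"
      using pos unfolding card_image[OF inj] \<eta>[symmetric] card\<S>[symmetric]
      by (simp add: power2_eq_square field_simps)
    finally show "?n * (\<Sum>v\<in>f ` \<S>. \<Sum>w\<in>f ` \<S>. ?c v w)
      \<le> (1 + \<eta>) * real (card (f ` \<S>)) ^ 2 * ?n ^ k" .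
  qed
qed

text \<open>The binary coordinates make two words incongruent modulo every integer \<open>\<ge> 2\<close> with high
  probability, so that torsion in \<open>G\<close> only matters for pairs agreeing in all of them.\<close>

lemma (in comm_group) prob_cayley_diam_le_comm:
  assumes fin: "finite (carrier G)" and Ufin: "finite U" "U \<noteq> {}"
    and U: "\<And>u. u \<in> U \<Longrightarrow> length u = k \<and> word_length u \<le> R \<and> (s = Plus \<longrightarrow> (\<forall>i\<in>set u. 0 \<le> i))"
    and M: "\<And>u i. u \<in> U \<Longrightarrow> i \<in> set u \<Longrightarrow> \<bar>i\<bar> \<le> int M"
    and \<eta>: "real ((2 * M) ^ min_generators G) / 2 ^ m + real (order G) / (real (card U) * 2 ^ m) = \<eta>"
  shows "1 - (sqrt \<eta> + real (order G) * sqrt \<eta> ^ J)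
    \<le> measure_pmf.prob (random_generators G (k + m + J)) {Z. cayley_diam s G Z \<le> enat (Suc (R + m))}"
proof -
  let ?n = "real (order G)" and ?D = "real ((2 * M) ^ min_generators G)"
  let ?B = "words {0, 1::int} m"
  let ?f = "\<lambda>(u, b). u @ b"
  let ?I = "U \<times> ?B"
  have n: "0 < ?n" using order_pos[OF fin] by simp
  have card_B: "card ?B = 2 ^ m" by (simp add: card_words numeral_2_eq_2)
  have finB: "finite ?B" by (simp add: finite_words)
  have N: "0 < real (card U)" using Ufin by (simp add: card_gt_0_iff)
  have inj: "inj_on ?f ?I" using U by (auto simp: inj_on_def)
  show ?thesis
  proof (rule prob_cayley_diam_le[OF fin])
    have "?B \<noteq> {}" using card_B by (metis card.empty power_not_zero zero_neq_numeral)
    then show "finite (?f ` ?I)" "?f ` ?I \<noteq> {}" using Ufin finB by auto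
    have "0 < ?n / (real (card U) * 2 ^ m)" using n N by simp
    moreover have "0 \<le> ?D / 2 ^ m" by simp
    ultimately show "0 < \<eta>" unfolding \<eta>[symmetric] by linarith
  next
    fix w assume "w \<in> ?f ` ?I"
    then obtain u b where w: "w = u @ b" and u: "u \<in> U" and b: "b \<in> ?B" by auto
    have b01: "i = 0 \<or> i = 1" if "i \<in> set b" for i using b that by (auto simp: words_def)
    have "word_length b \<le> length b"
      using b01 by (induction b) (fastforce simp: le_Suc_eq)+
    then show "length w = k + m \<and> word_length w \<le> R + m \<and> (s = Plus \<longrightarrow> (\<forall>i\<in>set w. 0 \<le> i))"
      using U[OF u] b b01 w by (fastforce simp: words_def)
  next
    let ?c = "\<lambda>v w. real (card {xs \<in> words (carrier G) (k + m). word_prod G v xs = word_prod G w xs})"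
    \<comment> \<open>Different binary parts have an exponent difference 1 or -1 somewhere, whose
      torsion is trivial. Pairs with equal binary parts are a proportion \<open>1 / 2 ^ m\<close> of
      all pairs and lose at most the torsion factor \<open>?D\<close>. Equal words always collide.
      The last two cases produce the two summands of \<open>\<eta>\<close>.\<close>
    have coll: "?n * ?c (?f p) (?f q) \<le>
        ?n ^ (k + m) * (1 + (if snd p = snd q then ?D else 0) + (if p = q then ?n else 0))"
      if p: "p \<in> ?I" and q: "q \<in> ?I" for p q
    proof -
      obtain u b where pe: "p = (u, b)" and u: "u \<in> U" and b: "b \<in> ?B" using p by auto
      obtain u' b' where qe: "q = (u', b')" and u': "u' \<in> U" and b': "b' \<in> ?B" using q by auto
      have len: "length u = k" "length u' = k" "length b = m" "length b' = m"
        using U[OF u] U[OF u'] b b' by (auto simp: words_def)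
      have step: "?n * ?c (u @ b) (u' @ b') \<le> ?n ^ (k + m) * real c"
        if i: "i < k + m" and c: "card {x \<in> carrier G. x [^] ((u @ b) ! i - (u' @ b') ! i) = \<one>} \<le> c" for i c
      proof -
        have "?c (u @ b) (u' @ b') \<le> real c * ?n ^ (k + m - 1)"
          using card_collision_le[OF fin _ _ i c] len
          unfolding of_nat_power[symmetric] of_nat_mult[symmetric] of_nat_le_iff by simp
        then have "?n * ?c (u @ b) (u' @ b') \<le> ?n * (real c * ?n ^ (k + m - 1))" using n by simp
        also have "\<dots> = ?n ^ (k + m) * real c" using i by (cases "k + m") auto
        finally show ?thesis .
      qed
      consider "p = q" | "b \<noteq> b'" | "b = b'" "u \<noteq> u'" using pe qe by blast
      then show ?thesis
      proof cases
        case 1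
        have "?n * ?c (?f p) (?f q) = ?n ^ (k + m) * ?n" using 1 by (simp add: card_words[OF fin] order_def)
        also have "\<dots> \<le> ?n ^ (k + m) * (1 + ?D + ?n)" using n by (intro mult_left_mono) auto
        finally show ?thesis using 1 by simp
      next
        case 2
        then obtain i where i: "i < m" "b ! i \<noteq> b' ! i" using len nth_equalityI[of b b'] by auto
        have "b ! i \<in> set b" "b' ! i \<in> set b'" using i(1) len by simp_all
        then have "b ! i = 0 \<or> b ! i = 1" "b' ! i = 0 \<or> b' ! i = 1"
          using b b' by (auto simp: words_def)
        then have "(u @ b) ! (k + i) - (u' @ b') ! (k + i) \<in> {1, -1}"
          using i(2) len(1,2) by (auto simp: nth_append)
        moreover have "x [^] e = \<one> \<longleftrightarrow> x = \<one>" if x: "x \<in> carrier G" and e: "e \<in> {1, -1}" for x and e :: int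
        proof -
          have "inv x = \<one> \<longleftrightarrow> x = \<one>" using inv_inv[OF x] inv_one by metis
          moreover have "x [^] (-1::int) = inv x" using int_pow_neg[OF x, of 1] x by simp
          moreover have "x [^] (1::int) = x" using x by simp
          moreover have "e = 1 \<or> e = -1" using e by blast
          ultimately show ?thesis by metis
        qed
        ultimately have "{x \<in> carrier G. x [^] ((u @ b) ! (k + i) - (u' @ b') ! (k + i)) = \<one>} = {\<one>}"
          by auto
        then have "?n * ?c (u @ b) (u' @ b') \<le> ?n ^ (k + m) * real 1"
          using i by (intro step[of "k + i"]) simp_all
        then show ?thesis using 2 pe qe by auto
      next
        case 3
        then obtain i where i: "i < k" "u ! i \<noteq> u' ! i" using len nth_equalityI[of u u'] by auto
        let ?e = "u ! i - u' ! i"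
        have "\<bar>u ! i\<bar> \<le> int M" "\<bar>u' ! i\<bar> \<le> int M"
          using M[OF u nth_mem] M[OF u' nth_mem] i len by auto
        then have "nat \<bar>?e\<bar> \<le> 2 * M" by linarith
        then have "nat \<bar>?e\<bar> ^ min_generators G \<le> (2 * M) ^ min_generators G" by (rule power_mono) simp
        with card_torsion_le_min_generators[OF fin, of ?e] i(2)
        have "card {x \<in> carrier G. x [^] ?e = \<one>} \<le> (2 * M) ^ min_generators G" by simp
        then have "?n * ?c (u @ b) (u' @ b') \<le> ?n ^ (k + m) * real ((2 * M) ^ min_generators G)"
          using i len by (intro step[of i]) (simp_all add: nth_append)
        also have "\<dots> \<le> ?n ^ (k + m) * (1 + ?D)"
          by (intro mult_left_mono) auto
        finally show ?thesis using 3 pe qe by auto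
      qed
    qed
    have "?n * (\<Sum>v\<in>?f ` ?I. \<Sum>w\<in>?f ` ?I. ?c v w) = (\<Sum>p\<in>?I. \<Sum>q\<in>?I. ?n * ?c (?f p) (?f q))"
      by (simp add: sum.reindex[OF inj] sum_distrib_left o_def)
    also have "\<dots> \<le> (\<Sum>p\<in>?I. \<Sum>q\<in>?I. ?n ^ (k + m) *
        (1 + (if snd p = snd q then ?D else 0) + (if p = q then ?n else 0)))"
      by (intro sum_mono coll)
    also have "\<dots> = (\<Sum>p\<in>?I. ?n ^ (k + m) * (real (card U) * 2 ^ m + real (card U) * ?D + ?n))"
    proof (rule sum.cong[OF refl])
      fix p assume p: "p \<in> ?I"
      have finI: "finite ?I" using Ufin finB by simp
      have "(\<Sum>q\<in>?I. if snd p = snd q then ?D else 0) = (\<Sum>u\<in>U. \<Sum>b\<in>?B. if snd p = b then ?D else 0)"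
        unfolding sum.cartesian_product case_prod_beta snd_conv ..
      also have "\<dots> = real (card U) * ?D"
        using p finB by (auto simp: sum.delta)
      finally have "(\<Sum>q\<in>?I. if snd p = snd q then ?D else 0) = real (card U) * ?D" .
      moreover have "(\<Sum>q\<in>?I. if p = q then ?n else 0) = ?n"
        using p finI by (simp only: sum.delta'[OF finI] if_True)
      moreover have "(\<Sum>q\<in>?I. 1::real) = real (card U) * 2 ^ m"
        by (simp add: card_cartesian_product card_B)
      ultimately show "(\<Sum>q\<in>?I. ?n ^ (k + m) * (1 + (if snd p = snd q then ?D else 0) + (if p = q then ?n else 0)))
          = ?n ^ (k + m) * (real (card U) * 2 ^ m + real (card U) * ?D + ?n)"
        by (simp only: sum_distrib_left[symmetric] sum.distrib)
    qed
    also have "\<dots> = (real (card U) * 2 ^ m) * (?n ^ (k + m) * (real (card U) * 2 ^ m + real (card U) * ?D + ?n))"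
      by (simp add: card_cartesian_product card_B)
    also have "\<dots> = (1 + \<eta>) * real (card (?f ` ?I)) ^ 2 * ?n ^ (k + m)"
      using N unfolding card_image[OF inj] \<eta>[symmetric] card_cartesian_product card_B
      by (simp add: power2_eq_square field_simps)
    finally show "?n * (\<Sum>v\<in>?f ` ?I. \<Sum>w\<in>?f ` ?I. ?c v w)
      \<le> (1 + \<eta>) * real (card (?f ` ?I)) ^ 2 * ?n ^ (k + m)" .
  qed
qed

section \<open>Asymptotics\<close>

lemma word_length_update_le: "word_length (w[i := w ! i + e]) \<le> word_length w + nat \<bar>e\<bar>"
proof (induction w arbitrary: i)
  case (Cons j w)
  then show ?case by (cases i) (auto simp: add.assoc)
qed simp

lemma word_ball_iff:
  "w \<in> word_ball s k R \<longleftrightarrow> length w = k \<and> real (word_length w) \<le> R \<and> (s = Plus \<longrightarrow> (\<forall>i\<in>set w. 0 \<le> i))"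
  by (simp add: word_ball_def real_word_length)

section \<open>Lower bounds by counting\<close>

context comm_group
begin

text \<open>Commutativity lets each step change one exponent in place, so a walk collapses to an
  exponent vector of norm at most its length. A generator that occurs repeatedly is charged to one
  of its positions.\<close>

lemma cayley_walk_imp_word:
  assumes fin: "finite (carrier G)" and xs: "set xs \<subseteq> carrier G"
    and walk: "(\<one>, v) \<in> cayley_adj s G (mset xs) ^^ r"
  shows "\<exists>w. w \<in> word_ball s (length xs) (real r) \<and> v = word_prod G w xs"
  using walk
proof (induction r arbitrary: v)
  case 0
  then show ?case using word_prod_replicate_0[OF xs] zero_in_word_ball[of 0 "length xs" s] by auto
next
  case (Suc r)
  from Suc.prems obtain u where u: "(\<one>, u) \<in> cayley_adj s G (mset xs) ^^ r" "(u, v) \<in> cayley_adj s G (mset xs)"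
    by (rule relpow_Suc_E)
  obtain w where w: "length w = length xs" "real (word_length w) \<le> real r" "s = Plus \<longrightarrow> (\<forall>i\<in>set w. 0 \<le> i)"
      and u_eq: "u = word_prod G w xs"
    using Suc.IH[OF u(1)] unfolding word_ball_iff by blast
  have z: "set_mset (mset xs) \<subseteq> carrier G" using xs by simp
  obtain x e where x: "x \<in># mset xs" and e: "e = 1 \<or> s = Minus \<and> e = (-1::int)" and v: "v = u \<otimes> x [^] e"
    using u(2) unfolding cayley_adj_iff[OF fin z] by blast
  obtain i where i: "i < length xs" "xs ! i = x" using x by (auto simp: in_set_conv_nth)
  let ?w = "w[i := w ! i + e]"
  have "v = word_prod G ?w xs"
    using word_prod_update[OF w(1) xs i(1)] i v u_eq by simp
  moreover have "word_length ?w \<le> word_length w + 1"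
    using word_length_update_le[of w i e] e by auto
  moreover have "\<forall>j\<in>set ?w. 0 \<le> j" if "s = Plus"
  proof -
    have "set ?w \<subseteq> insert (w ! i + e) (set w)" by (rule set_update_subset_insert)
    moreover have "0 \<le> w ! i + e" using that e w(3) nth_mem[of i w] i(1) w(1) by auto
    ultimately show ?thesis using w(3) that by blast
  qed
  ultimately show ?case
    using w(1,2) unfolding word_ball_iff by (intro exI[of _ ?w]) auto
qed

text \<open>If the diameter were some \<open>d < R\<close>, the lattice ball of radius
  \<open>R\<close> would map onto \<open>carrier G\<close>.\<close>

lemma cayley_diam_ge:
  assumes fin: "finite (carrier G)" and z: "set_mset z \<subseteq> carrier G"
    and card: "real (card (word_ball s (size z) R)) < real (order G)"
  shows "ereal R \<le> ereal_of_enat (cayley_diam s G z)"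
proof (cases "cayley_diam s G z")
  case (enat d)
  have "R \<le> real d"
  proof (rule ccontr)
    assume d: "\<not> R \<le> real d"
    obtain xs where xs: "mset xs = z" using ex_mset by blast
    have xsc: "set xs \<subseteq> carrier G" using xs z by auto
    have "carrier G \<subseteq> (\<lambda>w. word_prod G w xs) ` word_ball s (size z) R"
    proof
      fix v assume v: "v \<in> carrier G"
      have "cayley_diam s G z \<le> enat d" using enat by simp
      then obtain r where r: "r \<le> d" "(\<one>, v) \<in> cayley_adj s G (mset xs) ^^ r"
        unfolding cayley_diam_le_iff xs using v one_closed by blast
      from cayley_walk_imp_word[OF fin xsc r(2)]
      obtain w where w: "w \<in> word_ball s (length xs) (real r)" "v = word_prod G w xs" by blast
      have "length xs = size z" unfolding xs[symmetric] by simp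
      moreover have "real r \<le> R" using r(1) d by linarith
      ultimately have "w \<in> word_ball s (size z) R"
        using w(1) word_ball_mono[of "real r" R s "size z"] by auto
      with w(2) show "v \<in> (\<lambda>w. word_prod G w xs) ` word_ball s (size z) R" by blast
    qed
    then have "order G \<le> card (word_ball s (size z) R)"
      unfolding order_def by (rule surj_card_le[OF finite_word_ball])
    with card show False by simp
  qed
  with enat show ?thesis by simp
qed simp

end

text \<open>A product of \<open>m\<close> small balls keeps each entry within \<open>r\<close>,
  whereas the ball of radius \<open>real m * r\<close> has entries that grow with \<open>m\<close>.
  The torsion bound needs the former.\<close>

lemma block_words:
  assumes r: "0 \<le> r"
  obtains U where "finite U" "card U = card (word_ball s K r) ^ m"
    "U \<subseteq> word_ball s (m * K) (real m * r)" "\<And>u i. u \<in> U \<Longrightarrow> i \<in> set u \<Longrightarrow> real_of_int \<bar>i\<bar> \<le> r"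
proof -
  have "\<exists>U. finite U \<and> card U = card (word_ball s K r) ^ m \<and>
    U \<subseteq> word_ball s (m * K) (real m * r) \<and> (\<forall>u\<in>U. \<forall>i\<in>set u. real_of_int \<bar>i\<bar> \<le> r)"
  proof (induction m)
    case 0
    show ?case by (intro exI[of _ "{[]}"]) (auto simp: word_ball_def)
  next
    case (Suc m)
    then obtain U where U: "finite U" "card U = card (word_ball s K r) ^ m"
      "U \<subseteq> word_ball s (m * K) (real m * r)" "\<forall>u\<in>U. \<forall>i\<in>set u. real_of_int \<bar>i\<bar> \<le> r" by blast
    let ?V = "(\<lambda>(u, v). u @ v) ` (word_ball s K r \<times> U)"
    have "inj_on (\<lambda>(u, v). u @ v) (word_ball s K r \<times> U)"
      by (auto simp: inj_on_def word_ball_def)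
    then have "card ?V = card (word_ball s K r) ^ Suc m"
      using U(2) by (simp add: card_image card_cartesian_product)
    moreover have "finite ?V" using U(1) finite_word_ball by blast
    moreover have "?V \<subseteq> word_ball s (Suc m * K) (real (Suc m) * r)"
      using append_in_word_ball[of _ s K r _ "m * K" "real m * r"] U(3) by (auto simp: distrib_right)
    moreover have "\<forall>u\<in>?V. \<forall>i\<in>set u. real_of_int \<bar>i\<bar> \<le> r"
    proof (intro ballI)
      fix u i assume "u \<in> ?V" "i \<in> set u"
      then obtain v w where "v \<in> word_ball s K r" "w \<in> U" "i \<in> set v \<or> i \<in> set w" by auto
      then show "real_of_int \<bar>i\<bar> \<le> r" using word_ball_bound[of v s K r i] U(4) by blast
    qed
    ultimately show ?case by blast
  qed
  with that show thesis by blast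
qed

section \<open>Convergence in probability\<close>

lemma set_pmf_random_generators:
  assumes "finite (carrier G)" "carrier G \<noteq> {}" "z \<in> set_pmf (random_generators G k)"
  shows "set_mset z \<subseteq> carrier G" "size z = k"
  using assms by (auto simp: random_generators_def set_replicate_pmf)

text \<open>Fits the shape of the two bounds: the lower one holds for every choice of generators,
  and only the upper one is a statement about probabilities.\<close>

lemma tendsto_in_probI:
  assumes pos: "\<forall>\<^sub>F N in sequentially. 0 < c N"
    and lower: "\<And>\<epsilon>. 0 < \<epsilon> \<Longrightarrow> \<forall>\<^sub>F N in sequentially. \<forall>w\<in>set_pmf (P N). ereal ((1 - \<epsilon>) * c N) \<le> X N w"
    and upper: "\<And>\<epsilon>. 0 < \<epsilon> \<Longrightarrow> (\<lambda>N. measure_pmf.prob (P N) {w. X N w \<le> ereal ((1 + \<epsilon>) * c N)}) \<longlonglongrightarrow> 1"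
  shows "tendsto_in_prob P (\<lambda>N w. X N w / ereal (c N)) 1"
  unfolding tendsto_in_prob_def
proof (intro allI impI)
  fix \<epsilon> :: real assume \<epsilon>: "0 < \<epsilon>"
  let ?S = "\<lambda>N. {w. X N w \<le> ereal ((1 + \<epsilon>) * c N)}"
  have "(\<lambda>N. 1 - measure_pmf.prob (P N) (?S N)) \<longlonglongrightarrow> 1 - 1"
    by (intro tendsto_diff tendsto_const upper \<epsilon>)
  then have lim: "(\<lambda>N. 1 - measure_pmf.prob (P N) (?S N)) \<longlonglongrightarrow> 0" by simp
  have "\<forall>\<^sub>F N in sequentially. measure_pmf.prob (P N) {w. \<bar>X N w / ereal (c N) - ereal 1\<bar> > ereal \<epsilon>}
      \<le> 1 - measure_pmf.prob (P N) (?S N)"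
    using pos lower[OF \<epsilon>]
  proof eventually_elim
    case (elim N)
    have close: "\<bar>X N w / ereal (c N) - ereal 1\<bar> \<le> ereal \<epsilon>" if w: "w \<in> set_pmf (P N)" "w \<in> ?S N" for w
    proof -
      have "ereal ((1 - \<epsilon>) * c N) \<le> X N w" "X N w \<le> ereal ((1 + \<epsilon>) * c N)" using w elim by auto
      then obtain x where x: "X N w = ereal x" "(1 - \<epsilon>) * c N \<le> x" "x \<le> (1 + \<epsilon>) * c N"
        by (cases "X N w") auto
      then have "1 - \<epsilon> \<le> x / c N" "x / c N \<le> 1 + \<epsilon>"
        using elim(1) by (simp_all add: pos_le_divide_eq pos_divide_le_eq)
      then show ?thesis using elim(1) unfolding x(1) by simp
    qed
    have "measure_pmf.prob (P N) {w. \<bar>X N w / ereal (c N) - ereal 1\<bar> > ereal \<epsilon>}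
        \<le> measure_pmf.prob (P N) (- ?S N)"
    proof (rule measure_pmf.finite_measure_mono_AE)
      show "AE w in measure_pmf (P N). w \<in> {w. \<bar>X N w / ereal (c N) - ereal 1\<bar> > ereal \<epsilon>} \<longrightarrow> w \<in> - ?S N"
        unfolding AE_measure_pmf_iff using close by (auto simp: not_le[symmetric])
    qed simp
    also have "\<dots> = 1 - measure_pmf.prob (P N) (?S N)"
      using measure_pmf.prob_compl[of "?S N" "P N"] by (simp add: Compl_eq_Diff_UNIV)
    finally show ?case .
  qed
  then show "(\<lambda>N. measure_pmf.prob (P N) {w. \<bar>X N w / ereal (c N) - ereal 1\<bar> > ereal \<epsilon>}) \<longlonglongrightarrow> 0"
    by (intro tendsto_sandwich[OF _ _ tendsto_const lim]) simp_all
qed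

lemma failure_bound_tendsto_0:
  fixes n \<eta> :: "nat \<Rightarrow> real" and J :: "nat \<Rightarrow> nat"
  assumes n: "filterlim n at_top sequentially" and \<eta>: "\<eta> \<longlonglongrightarrow> 0" and \<eta>0: "\<And>N. 0 \<le> \<eta> N"
    and c: "0 < c" and J: "\<forall>\<^sub>F N in sequentially. c * ln (n N) \<le> real (J N)"
  shows "(\<lambda>N. sqrt (\<eta> N) + n N * sqrt (\<eta> N) ^ J N) \<longlonglongrightarrow> 0"
proof -
  have sqrt_lim: "(\<lambda>N. sqrt (\<eta> N)) \<longlonglongrightarrow> 0" using tendsto_real_sqrt[OF \<eta>] by simp
  have "(\<lambda>N. n N * sqrt (\<eta> N) ^ J N) \<longlonglongrightarrow> 0"
  proof (rule tendsto_sandwich[OF _ _ tendsto_const])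
    have npos: "\<forall>\<^sub>F N in sequentially. 0 < n N" using n by (simp add: filterlim_at_top_dense)
    show "\<forall>\<^sub>F N in sequentially. 0 \<le> n N * sqrt (\<eta> N) ^ J N"
      using npos by eventually_elim (simp add: \<eta>0)
    have "\<forall>\<^sub>F N in sequentially. sqrt (\<eta> N) < exp (- 2 / c)"
      using order_tendstoD(2)[OF sqrt_lim, of "exp (- 2 / c)"] by simp
    with npos J show "\<forall>\<^sub>F N in sequentially. n N * sqrt (\<eta> N) ^ J N \<le> inverse (n N)"
    proof eventually_elim
      case (elim N)
      \<comment> \<open>A base below \<open>exp (- 2 / c)\<close> with exponent at least
        \<open>c * ln n\<close> gives at most \<open>n powr (- 2)\<close>; after the factor
        \<open>n\<close> from the union bound \<open>1 / n\<close> is left.\<close>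
      have "sqrt (\<eta> N) ^ J N \<le> exp (- 2 / c) ^ J N"
        using elim(3) \<eta>0 by (intro power_mono) auto
      also have "\<dots> = exp (real (J N) * (- 2 / c))" unfolding exp_of_nat_mult ..
      also have "\<dots> \<le> exp (- ln (n N) + - ln (n N))"
        using elim(2) c by (simp add: field_simps)
      also have "\<dots> = inverse (n N) * inverse (n N)"
        unfolding exp_add exp_minus using elim(1) by simp
      finally have "n N * sqrt (\<eta> N) ^ J N \<le> n N * (inverse (n N) * inverse (n N))"
        using elim(1) by simp
      also have "\<dots> = inverse (n N)" using elim(1) by simp
      finally show ?case .
    qed
    show "(\<lambda>N. inverse (n N)) \<longlonglongrightarrow> 0"
      using n by (rule tendsto_inverse_0_at_top)
  qed
  from tendsto_add[OF sqrt_lim this] show ?thesis by simp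
qed

lemma prob_tendsto_1:
  assumes "\<forall>\<^sub>F N in sequentially. 1 - f N \<le> measure_pmf.prob (P N) (A N)" "f \<longlonglongrightarrow> 0"
  shows "(\<lambda>N. measure_pmf.prob (P N) (A N)) \<longlonglongrightarrow> 1"
proof (rule tendsto_sandwich[OF assms(1) _ _ tendsto_const])
  show "(\<lambda>N. 1 - f N) \<longlonglongrightarrow> 1" using tendsto_diff[OF tendsto_const assms(2), of 1] by simp
qed simp

text \<open>Below the critical radius the growth rate is less than \<open>1 / l\<close>, so the
  bound \<open>exp (k * ball_growth s a)\<close> is eventually a power of \<open>n\<close> with
  exponent below 1.\<close>

lemma word_ball_small_linear:
  fixes k :: "nat \<Rightarrow> nat" and n :: "nat \<Rightarrow> real"
  assumes n: "filterlim n at_top sequentially" and l: "0 < l" "(\<lambda>N. real (k N) / ln (n N)) \<longlonglongrightarrow> l"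
    and kpos: "\<And>N. 0 < k N" and \<epsilon>: "0 < \<epsilon>" "\<epsilon> < 1"
  shows "\<forall>\<^sub>F N in sequentially. real (card (word_ball s (k N) ((1 - \<epsilon>) * alpha s l * real (k N)))) < n N"
proof -
  let ?a = "(1 - \<epsilon>) * alpha s l"
  have \<alpha>: "0 < alpha s l" by (rule alpha_pos[OF l(1)])
  have a: "0 < ?a" "?a < alpha s l" using \<alpha> \<epsilon> by (simp_all add: mult_less_cancel_right2)
  have "ball_growth s ?a < 1 / l"
    using ball_growth_strict_mono[OF a, of s] unfolding ball_growth_alpha[OF l(1)] .
  then have "l * ball_growth s ?a < 1" using l(1) by (simp add: field_simps)
  moreover have "(\<lambda>N. real (k N) / ln (n N) * ball_growth s ?a) \<longlonglongrightarrow> l * ball_growth s ?a"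
    by (intro tendsto_mult l(2) tendsto_const)
  ultimately have "\<forall>\<^sub>F N in sequentially. real (k N) / ln (n N) * ball_growth s ?a < 1"
    by (intro order_tendstoD(2))
  moreover have "\<forall>\<^sub>F N in sequentially. 1 < n N" using n by (simp add: filterlim_at_top_dense)
  ultimately show ?thesis
  proof eventually_elim
    case (elim N)
    have ln: "0 < ln (n N)" using elim(2) by simp
    have "ln (real (card (word_ball s (k N) (?a * real (k N))))) \<le> ball_growth s ?a * real (k N)"
      using ball_growth_limit(2)[OF a(1) kpos[of N], of s] kpos[of N] by (simp add: pos_divide_le_eq)
    also have "\<dots> < ln (n N)" using elim(1) ln by (simp add: field_simps)
    finally have "ln (real (card (word_ball s (k N) (?a * real (k N))))) < ln (n N)" .
    moreover have "0 < card (word_ball s (k N) (?a * real (k N)))"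
      using a by (intro card_word_ball_pos) simp
    ultimately show ?case using elim(2) by (subst (asm) ln_less_cancel_iff) auto
  qed
qed

text \<open>With \<open>\<rho> = ln k / ln (ln n)\<close> one has
  \<open>\<rho> - 1 = ln (k / ln n) / ln (ln n)\<close>, and the iterated logarithms cancel. The
  assumptions ensure \<open>\<rho> > 1\<close>.\<close>

lemma typical_radius_eq:
  fixes k n :: real
  assumes "1 < ln n" "ln n < k"
  shows "(ln k / ln (ln n)) / (ln k / ln (ln n) - 1) * log k n = ln n / ln (k / ln n)"
proof -
  let ?L = "ln (ln n)"
  have L: "0 < ?L" using assms by simp
  have "?L < ln k" using assms by (subst ln_less_cancel_iff) auto
  moreover have "ln (k / ln n) = ln k - ?L" using assms by (simp add: ln_div)
  ultimately show ?thesis using L by (simp add: log_def field_simps)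
qed

lemma ln_quotient_le:
  fixes t :: real
  assumes "0 < t" "t \<le> 1 / 2"
  shows "ln ((1 + t) / (1 - t)) \<le> 4 * t"
proof -
  have "ln ((1 + t) / (1 - t)) \<le> (1 + t) / (1 - t) - 1"
    using assms by (intro ln_le_minus_one) simp
  also have "\<dots> = 2 * t / (1 - t)" using assms by (simp add: field_simps)
  also have "\<dots> \<le> 2 * t / (1 / 2)" using assms by (intro divide_left_mono) auto
  finally show ?thesis by simp
qed

text \<open>In terms of \<open>x = k / ln n\<close> the Chernoff bound becomes \<open>n\<close> to
  the power \<open>?g x\<close>, and \<open>?g x\<close> tends to
  \<open>1 - \<epsilon>\<close>.\<close>

lemma word_ball_small_superlinear:
  fixes k :: "nat \<Rightarrow> nat" and n :: "nat \<Rightarrow> real"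
  assumes n: "filterlim n at_top sequentially" and \<kappa>: "filterlim (\<lambda>N. real (k N) / ln (n N)) at_top sequentially"
    and \<epsilon>: "0 < \<epsilon>" "\<epsilon> < 1"
  shows "\<forall>\<^sub>F N in sequentially.
    real (card (word_ball s (k N) ((1 - \<epsilon>) * (ln (n N) / ln (real (k N) / ln (n N)))))) < n N"
proof -
  let ?g = "\<lambda>x::real. (1 - \<epsilon>) * (1 + ln (ln x) / ln x) + 4 / ln x"
  have "((\<lambda>x. (1 - \<epsilon>) * (1 + ln (ln x) / ln x) + 4 / ln x) \<longlongrightarrow> (1 - \<epsilon>) * (1 + 0) + 0) at_top"
    by (intro tendsto_intros; real_asymp)
  from order_tendstoD(2)[OF this, of 1] have "\<forall>\<^sub>F x in at_top. ?g x < 1" using \<epsilon> by simp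
  \<comment> \<open>\<open>exp 2 \<le> x\<close> gives \<open>2 \<le> ln x\<close>, and with it
    \<open>t \<le> 1 / 2\<close> for the \<open>t\<close> chosen in the Chernoff bound.\<close>
  then have ev: "\<forall>\<^sub>F x in at_top. ?g x < 1 \<and> exp 2 \<le> x"
    using eventually_ge_at_top by (rule eventually_conj)
  from eventually_compose_filterlim[OF ev \<kappa>] have "\<forall>\<^sub>F N in sequentially. ?g (real (k N) / ln (n N)) < 1 \<and> exp 2 \<le> real (k N) / ln (n N)" .
  moreover have "\<forall>\<^sub>F N in sequentially. 1 < n N" using n by (simp add: filterlim_at_top_dense)
  ultimately show ?thesis
  proof eventually_elim
    case (elim N)
    define L x where "L = ln (n N)" and "x = real (k N) / L"
    have L: "0 < L" using elim(2) by (simp add: L_def)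
    have g: "?g x < 1" and x: "exp 2 \<le> x" using elim(1) by (auto simp: x_def L_def)
    have x0: "0 < x" using x less_le_trans[OF exp_gt_zero] by blast
    then have lnx: "2 \<le> ln x" using x by (simp add: ln_ge_iff)
    have x1: "1 \<le> x" using x lnx x0 by (metis ln_ge_zero_iff order_trans zero_le_numeral)
    \<comment> \<open>Minimising \<open>- R * ln t + 2 * k * t\<close> gives
      \<open>t = R / (2 * k)\<close>, which is \<open>1 / (x * ln x)\<close> up to a constant
      factor.\<close>
    define t where "t = 1 / (x * ln x)"
    have xlnx: "2 \<le> x * ln x" using mult_mono[of 1 x 2 "ln x"] x1 lnx by simp
    have t: "0 < t" "t \<le> 1 / 2" unfolding t_def using xlnx by (simp_all add: field_simps)
    define R where "R = (1 - \<epsilon>) * (L / ln x)"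
    have R: "0 \<le> R" unfolding R_def using \<epsilon> L lnx by simp
    have lnx0: "0 < ln x" using lnx by linarith
    have "ln (x * ln x) = ln x + ln (ln x)" by (rule ln_mult_pos[OF x0 lnx0])
    then have lnt: "- ln t = ln x + ln (ln x)"
      unfolding t_def using xlnx by (simp add: ln_div)
    have kx: "real (k N) = x * L" unfolding x_def using L by simp
    have "ln (real (card (word_ball s (k N) R))) \<le> - R * ln t + real (k N) * ln ((1 + t) / (1 - t))"
      using t R by (intro ln_card_word_ball_le) auto
    also have "\<dots> \<le> R * (ln x + ln (ln x)) + real (k N) * (4 * t)"
    proof -
      have "- R * ln t = R * (ln x + ln (ln x))" unfolding lnt[symmetric] by simp
      then show ?thesis
        by (simp only:) (intro add_left_mono mult_left_mono ln_quotient_le[OF t], simp)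
    qed
    also have "\<dots> = L * ?g x"
    proof -
      have "(1 - \<epsilon>) * (L / y) * (y + z) + x * L * (4 * (1 / (x * y))) = L * ((1 - \<epsilon>) * (1 + z / y) + 4 / y)"
        if "y \<noteq> 0" for y z
        using x0 that by (simp add: field_simps)
      from this[OF lnx0[THEN less_imp_neq, THEN not_sym]] show ?thesis
        unfolding R_def kx t_def .
    qed
    also have "\<dots> < L * 1" using g L by (rule mult_strict_left_mono)
    finally have "ln (real (card (word_ball s (k N) R))) < ln (n N)" by (simp add: L_def)
    moreover have "0 < card (word_ball s (k N) R)" using R by (rule card_word_ball_pos)
    ultimately have "real (card (word_ball s (k N) R)) < n N"
      using elim(2) by (subst (asm) ln_less_cancel_iff) auto
    then show ?case unfolding R_def x_def L_def .
  qed
qed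

lemma ereal_nonpos_le_of_enat: "x \<le> 0 \<Longrightarrow> ereal x \<le> ereal_of_enat d"
  by (cases d) auto

section \<open>Sequences of groups in the two regimes\<close>

locale random_cayley =
  fixes G :: "nat \<Rightarrow> ('a, 'b) monoid_scheme" and k :: "nat \<Rightarrow> nat" and n :: "nat \<Rightarrow> real"
  assumes grp: "\<And>N. group (G N)"
    and fin: "\<And>N. finite (carrier (G N))"
    and n_def: "\<And>N. n N = real (order (G N))"
    and n_lim: "filterlim n at_top sequentially"
    and k_pos: "\<And>N. k N > 0"
begin

lemma eventually_n_gt: "\<forall>\<^sub>F N in sequentially. c < n N"
  using n_lim by (simp add: filterlim_at_top_dense)

lemma ln_n_lim: "filterlim (\<lambda>N. ln (n N)) at_top sequentially"
  using ln_at_top n_lim by (rule filterlim_compose)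

lemma eventually_ln_n_gt: "\<forall>\<^sub>F N in sequentially. c < ln (n N)"
  using ln_n_lim by (simp add: filterlim_at_top_dense)

lemma prob_diam_le_tendsto_1:
  assumes "\<forall>\<^sub>F N in sequentially. \<exists>R. (1 - f N \<le> measure_pmf.prob (random_generators (G N) (k N)) {Z. cayley_diam s (G N) Z \<le> enat R})
      \<and> real R \<le> B N" and f: "f \<longlonglongrightarrow> 0"
  shows "(\<lambda>N. measure_pmf.prob (random_generators (G N) (k N))
     {Z. ereal_of_enat (cayley_diam s (G N) Z) \<le> ereal (B N)}) \<longlonglongrightarrow> 1"
proof (rule prob_tendsto_1[OF _ f])
  show "\<forall>\<^sub>F N in sequentially. 1 - f N \<le> measure_pmf.prob (random_generators (G N) (k N))
     {Z. ereal_of_enat (cayley_diam s (G N) Z) \<le> ereal (B N)}"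
    using assms(1)
  proof eventually_elim
    case (elim N)
    then obtain R where R: "1 - f N \<le> measure_pmf.prob (random_generators (G N) (k N)) {Z. cayley_diam s (G N) Z \<le> enat R}"
      "real R \<le> B N" by blast
    have "{Z. cayley_diam s (G N) Z \<le> enat R} \<subseteq> {Z. ereal_of_enat (cayley_diam s (G N) Z) \<le> ereal (B N)}"
    proof clarify
      fix Z assume "cayley_diam s (G N) Z \<le> enat R"
      then obtain d where "cayley_diam s (G N) Z = enat d" "d \<le> R"
        by (cases "cayley_diam s (G N) Z") auto
      then show "ereal_of_enat (cayley_diam s (G N) Z) \<le> ereal (B N)" using R(2) by simp
    qed
    from measure_pmf.finite_measure_mono[OF this] R(1) show ?case by (auto intro: order_trans)
  qed
qed

lemma lower_bound_linear:
  assumes comm: "\<And>N. comm_group (G N)" and l: "0 < l" "(\<lambda>N. real (k N) / ln (n N)) \<longlonglongrightarrow> l" and \<epsilon>: "0 < \<epsilon>"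
  shows "\<forall>\<^sub>F N in sequentially. \<forall>z. set_mset z \<subseteq> carrier (G N) \<and> size z = k N \<longrightarrow>
    ereal ((1 - \<epsilon>) * alpha s l * real (k N)) \<le> ereal_of_enat (cayley_diam s (G N) z)"
proof (cases "\<epsilon> < 1")
  case True
  show ?thesis using word_ball_small_linear[OF n_lim l k_pos \<epsilon> True, of s]
  proof eventually_elim
    case (elim N)
    then show ?case
      using comm_group.cayley_diam_ge[OF comm fin, of _ N s] unfolding n_def by auto
  qed
next
  case False
  have "(1 - \<epsilon>) * alpha s l * real (k N) \<le> 0" for N
    using False alpha_pos[OF l(1), of s] by (intro mult_nonpos_nonneg) auto
  then have "ereal ((1 - \<epsilon>) * alpha s l * real (k N)) \<le> ereal_of_enat (cayley_diam s (G N) z)" for N z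
    by (rule ereal_nonpos_le_of_enat)
  then show ?thesis by simp
qed

text \<open>This is \<open>\<rho> / (\<rho> - 1) * log k n\<close> written without \<open>\<rho>\<close>.\<close>

definition typical_radius :: "nat \<Rightarrow> real" where
  "typical_radius N = ln (n N) / ln (real (k N) / ln (n N))"

context
  assumes \<kappa>: "filterlim (\<lambda>N. real (k N) / ln (n N)) at_top sequentially"
begin

lemma eventually_k_gt: "0 < c \<Longrightarrow> \<forall>\<^sub>F N in sequentially. c * ln (n N) < real (k N)"
  using \<kappa>[unfolded filterlim_at_top_dense, rule_format, of c] eventually_ln_n_gt[of 0]
  by eventually_elim (simp add: pos_less_divide_eq)

lemma eventually_typical_radius:
  assumes "\<And>N. \<rho> N = ln (real (k N)) / ln (ln (n N))"
  shows "\<forall>\<^sub>F N in sequentially. \<rho> N / (\<rho> N - 1) * log (real (k N)) (n N) = typical_radius N"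
  using eventually_k_gt[OF zero_less_one] eventually_ln_n_gt[of 1]
  unfolding assms typical_radius_def by eventually_elim (rule typical_radius_eq, simp_all)

lemma eventually_typical_radius_pos: "\<forall>\<^sub>F N in sequentially. 0 < typical_radius N"
  using eventually_k_gt[OF zero_less_one] eventually_ln_n_gt[of 1]
  by eventually_elim (simp add: typical_radius_def pos_less_divide_eq)

lemma lower_bound_superlinear:
  assumes comm: "\<And>N. comm_group (G N)" and \<epsilon>: "0 < \<epsilon>"
  shows "\<forall>\<^sub>F N in sequentially. \<forall>z. set_mset z \<subseteq> carrier (G N) \<and> size z = k N \<longrightarrow>
    ereal ((1 - \<epsilon>) * typical_radius N) \<le> ereal_of_enat (cayley_diam s (G N) z)"
proof (cases "\<epsilon> < 1")
  case True
  show ?thesis using word_ball_small_superlinear[OF n_lim \<kappa> \<epsilon> True, of s]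
  proof eventually_elim
    case (elim N)
    then show ?case
      using comm_group.cayley_diam_ge[OF comm fin, of _ N s] unfolding n_def typical_radius_def by auto
  qed
next
  case False
  show ?thesis using eventually_typical_radius_pos
  proof eventually_elim
    case (elim N)
    then have "(1 - \<epsilon>) * typical_radius N \<le> 0" using False by (intro mult_nonpos_nonneg) auto
    then show ?case by (simp add: ereal_nonpos_le_of_enat)
  qed
qed

text \<open>The radius is at least \<open>ln n / ln k\<close>, the reciprocal of a null sequence.
  Its divergence makes rounding and the last step negligible.\<close>

lemma typical_radius_lim:
  assumes "(\<lambda>N. ln (real (k N)) / ln (n N)) \<longlonglongrightarrow> 0"
  shows "filterlim typical_radius at_top sequentially"
proof -
  have "filterlim (\<lambda>N. inverse (ln (real (k N)) / ln (n N))) at_top sequentially"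
    using assms
  proof (rule filterlim_inverse_at_top)
    show "\<forall>\<^sub>F N in sequentially. 0 < ln (real (k N)) / ln (n N)"
      using eventually_k_gt[OF zero_less_one] eventually_ln_n_gt[of 1] by eventually_elim simp
  qed
  then show ?thesis
  proof (rule filterlim_at_top_mono)
    show "\<forall>\<^sub>F N in sequentially. inverse (ln (real (k N)) / ln (n N)) \<le> typical_radius N"
      using eventually_k_gt[OF zero_less_one] eventually_ln_n_gt[of 1]
    proof eventually_elim
      case (elim N)
      have "real (k N) / ln (n N) \<le> real (k N)" "1 < real (k N) / ln (n N)"
        using elim by (simp_all add: divide_le_eq pos_less_divide_eq mult_le_cancel_left1)
      then have "ln (real (k N) / ln (n N)) \<le> ln (real (k N))" "0 < ln (real (k N) / ln (n N))"
        by (simp_all add: ln_le_cancel_iff)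
      then show ?case unfolding typical_radius_def using elim
        by (simp add: divide_left_mono)
    qed
  qed
qed

lemma upper_bound_superlinear:
  assumes k: "(\<lambda>N. ln (real (k N)) / ln (n N)) \<longlonglongrightarrow> 0" and \<epsilon>: "0 < \<epsilon>"
  shows "(\<lambda>N. measure_pmf.prob (random_generators (G N) (k N))
     {Z. ereal_of_enat (cayley_diam s (G N) Z) \<le> ereal ((1 + \<epsilon>) * typical_radius N)}) \<longlonglongrightarrow> 1"
proof -
  \<comment> \<open>Half of \<open>\<epsilon>\<close> raises the number of words to
    \<open>n powr (1 + \<epsilon> / 2)\<close>; the other half pays for rounding up and for the last
    step.\<close>
  define R where "R N = nat \<lceil>(1 + \<epsilon> / 2) * typical_radius N\<rceil>" for N
  define J where "J N = k N div 2" for N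
  define m where "m N = k N - J N" for N
  define \<eta> where "\<eta> N = n N / real (m N choose R N)" for N
  have mJ: "m N + J N = k N" for N by (simp add: m_def J_def)
  have R_ge: "(1 + \<epsilon> / 2) * typical_radius N \<le> real (R N)" for N
    unfolding R_def by (rule real_nat_ceiling_ge)
  have R_le: "\<forall>\<^sub>F N in sequentially. real (Suc (R N)) \<le> (1 + \<epsilon>) * typical_radius N"
    using typical_radius_lim[OF k, unfolded filterlim_at_top, rule_format, of "4 / \<epsilon>"]
      eventually_typical_radius_pos
  proof eventually_elim
    case (elim N)
    have "0 \<le> (1 + \<epsilon> / 2) * typical_radius N" using elim(2) \<epsilon> by simp
    then have "real (R N) \<le> (1 + \<epsilon> / 2) * typical_radius N + 1"
      unfolding R_def by linarith
    moreover have "2 \<le> \<epsilon> / 2 * typical_radius N" using elim(1) \<epsilon> by (simp add: field_simps)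
    ultimately show ?case by (simp add: algebra_simps)
  qed
  \<comment> \<open>\<open>k > C * ln n\<close> means \<open>ln x > 2 * (1 + \<epsilon>)\<close>, so
    that \<open>R * x \<le> k / 2 \<le> m\<close>. The factor \<open>1 / ln x\<close> in the radius
    thus absorbs giving away half of the generators.\<close>
  define C where "C = exp (2 * (1 + \<epsilon>))"
  have C: "1 < C" "0 < C" using \<epsilon> by (simp_all add: C_def)
  have binomial: "\<forall>\<^sub>F N in sequentially. R N \<le> m N \<and> n N powr (1 + \<epsilon> / 2) \<le> real (m N choose R N)"
    using R_le eventually_k_gt[OF C(2)] eventually_ln_n_gt[of 1] eventually_n_gt[of 1] eventually_typical_radius_pos
  proof eventually_elim
    case (elim N)
    define L x where "L = ln (n N)" and "x = real (k N) / L"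
    have L: "1 < L" using elim(3) by (simp add: L_def)
    have x: "C < x" unfolding x_def L_def using elim(2,3) by (simp add: pos_less_divide_eq)
    have x1: "1 < x" using x C by simp
    have lnx: "2 * (1 + \<epsilon>) \<le> ln x"
    proof -
      have "ln C \<le> ln x" using x C by (subst ln_le_cancel_iff) auto
      then show ?thesis by (simp add: C_def)
    qed
    have lnx0: "0 < ln x" using x1 by simp
    have T: "typical_radius N = L / ln x" by (simp add: typical_radius_def L_def x_def)
    have kx: "real (k N) = x * L" unfolding x_def using L by simp
    have Rpos: "0 < real (R N)"
      using R_ge[of N] elim(5) \<epsilon> by (smt (verit, best) divide_pos_pos mult_pos_pos)
    have "real (R N) * x \<le> (1 + \<epsilon>) * (L / ln x) * x"
      using elim(1) x1 unfolding T by (intro mult_right_mono) auto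
    also have "\<dots> = (1 + \<epsilon>) / ln x * real (k N)" unfolding kx by simp
    also have "\<dots> \<le> 1 / 2 * real (k N)"
      using lnx lnx0 by (intro mult_right_mono) (simp_all add: divide_le_eq)
    also have "\<dots> \<le> real (m N)" unfolding m_def J_def by linarith
    finally have Rx: "real (R N) * x \<le> real (m N)" .
    have "real (R N) * 1 \<le> real (R N) * x" using Rpos x1 by (intro mult_left_mono) auto
    with Rx have Rm: "R N \<le> m N" by linarith
    \<comment> \<open>\<open>R * ln x\<close> is at least
      \<open>(1 + \<epsilon> / 2) * ln n\<close>, and the binomial coefficient is at least
      \<open>(m / R) ^ R \<ge> x ^ R\<close>.\<close>
    have "n N powr (1 + \<epsilon> / 2) = exp ((1 + \<epsilon> / 2) * (L / ln x) * ln x)"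
      using elim(4) lnx0 by (simp add: powr_def L_def)
    also have "\<dots> \<le> exp (real (R N) * ln x)"
      using R_ge[of N] lnx0 unfolding T by (simp add: mult_right_mono del: times_divide_eq_right times_divide_eq_left)
    also have "\<dots> = x ^ R N" using x1 by (simp add: exp_of_nat_mult)
    also have "\<dots> \<le> (real (m N) / real (R N)) ^ R N"
      using Rx Rpos x1 by (intro power_mono) (simp_all add: pos_le_divide_eq mult.commute)
    also have "\<dots> \<le> real (m N choose R N)"
      using binomial_ge_n_over_k_pow_k[OF Rm, where ?'a = real] .
    finally show ?case using Rm by simp
  qed
  have "\<eta> \<longlonglongrightarrow> 0"
  proof (rule tendsto_sandwich[OF _ _ tendsto_const])
    show "\<forall>\<^sub>F N in sequentially. 0 \<le> \<eta> N" by (simp add: \<eta>_def n_def)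
    show "\<forall>\<^sub>F N in sequentially. \<eta> N \<le> n N powr (- \<epsilon> / 2)"
      using binomial eventually_n_gt[of 1]
    proof eventually_elim
      case (elim N)
      have pos: "0 < n N powr (1 + \<epsilon> / 2)" using elim(2) by simp
      have "\<eta> N \<le> n N / n N powr (1 + \<epsilon> / 2)"
        unfolding \<eta>_def using elim pos by (intro divide_left_mono mult_pos_pos) auto
      also have "\<dots> = n N powr (1 - (1 + \<epsilon> / 2))"
        unfolding powr_diff using elim(2) by simp
      also have "\<dots> = n N powr (- \<epsilon> / 2)" by simp
      finally show ?case .
    qed
    show "(\<lambda>N. n N powr (- \<epsilon> / 2)) \<longlonglongrightarrow> 0"
      using \<epsilon> by (intro tendsto_neg_powr n_lim) auto
  qed
  moreover have "0 \<le> \<eta> N" for N by (simp add: \<eta>_def n_def)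
  moreover note zero_less_one
  moreover have "\<forall>\<^sub>F N in sequentially. 1 * ln (n N) \<le> real (J N)"
    using eventually_k_gt[of 4, simplified] eventually_ln_n_gt[of 1]
  proof eventually_elim
    case (elim N)
    have "real (k N) \<le> 2 * real (J N) + 1" unfolding J_def by linarith
    with elim show ?case by linarith
  qed
  ultimately have lim: "(\<lambda>N. sqrt (\<eta> N) + n N * sqrt (\<eta> N) ^ J N) \<longlonglongrightarrow> 0"
    by (rule failure_bound_tendsto_0[OF n_lim])
  show ?thesis
  proof (rule prob_diam_le_tendsto_1[OF _ lim])
    show "\<forall>\<^sub>F N in sequentially. \<exists>r. 1 - (sqrt (\<eta> N) + n N * sqrt (\<eta> N) ^ J N)
        \<le> measure_pmf.prob (random_generators (G N) (k N)) {Z. cayley_diam s (G N) Z \<le> enat r} \<and>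
        real r \<le> (1 + \<epsilon>) * typical_radius N"
      using binomial R_le
    proof eventually_elim
      case (elim N)
      have "real (order (G N)) / real (m N choose R N) = \<eta> N" by (simp add: \<eta>_def n_def)
      from group.prob_cayley_diam_le_binomial[OF grp fin _ this, of "J N" s] elim
      show ?case unfolding mJ n_def by blast
    qed
  qed
qed

end

end

section \<open>Upper bound for k of order ln |G|\<close>

context random_cayley
begin

lemma upper_bound_linear:
  assumes comm: "\<And>N. comm_group (G N)" and l: "0 < l" "(\<lambda>N. real (k N) / ln (n N)) \<longlonglongrightarrow> l"
    and d: "\<forall>\<^sub>F N in sequentially. real (min_generators (G N)) \<le> 1 / 4 * ln (n N) / ln (ln (n N))"
    and \<epsilon>: "0 < \<epsilon>"
  shows "(\<lambda>N. measure_pmf.prob (random_generators (G N) (k N))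
     {Z. ereal_of_enat (cayley_diam s (G N) Z) \<le> ereal ((1 + \<epsilon>) * (alpha s l * real (k N)))}) \<longlonglongrightarrow> 1"
proof -
  \<comment> \<open>Above \<open>alpha s l\<close> the balls outgrow the group; below
    \<open>(1 + \<epsilon>) * alpha s l\<close> there is room for the overhead.\<close>
  define a where "a = (1 + \<epsilon> / 2) * alpha s l"
  have \<alpha>: "0 < alpha s l" by (rule alpha_pos[OF l(1)])
  have a: "0 < a" "alpha s l < a" "a < (1 + \<epsilon>) * alpha s l"
    using \<alpha> \<epsilon> by (simp_all add: a_def)
  have "1 / l < ball_growth s a"
    using ball_growth_strict_mono[OF \<alpha> a(2), of s] unfolding ball_growth_alpha[OF l(1)] .
  then have growth: "1 < l * ball_growth s a" using l(1) by (simp add: field_simps)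
  define b where "b K = ln (real (card (word_ball s K (a * real K))))" for K :: nat
  \<comment> \<open>A block takes \<open>K + 2\<close> generators: \<open>K\<close> for a ball, one
    for a binary exponent, one for the last step. For large \<open>K\<close> the blocks still yield
    more than \<open>n\<close> words, and the radius \<open>a * K + 1\<close> per block, with 1 for
    the binary exponent, stays within the target.\<close>
  have ratio: "(\<lambda>K. real K / (real K + 2)) \<longlonglongrightarrow> 1" by real_asymp
  have "(\<lambda>K. l * (b K / real K * (real K / (real K + 2)))) \<longlonglongrightarrow> l * (ball_growth s a * 1)"
    unfolding b_def by (intro tendsto_mult tendsto_const ratio ball_growth_limit(1)[OF a(1)])
  then have "\<forall>\<^sub>F K in sequentially. 1 < l * (b K / real K * (real K / (real K + 2)))"
    using growth by (intro order_tendstoD(1)) auto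
  moreover have "(\<lambda>K. (a * real K + 1) / (real K + 2)) \<longlonglongrightarrow> a" by real_asymp
  then have "\<forall>\<^sub>F K in sequentially. (a * real K + 1) / (real K + 2) < (1 + \<epsilon>) * alpha s l"
    using a(3) by (rule order_tendstoD(2))
  ultimately have ev: "\<forall>\<^sub>F K in sequentially. 0 < K \<and> 1 < l * (b K / real K * (real K / (real K + 2))) \<and>
      (a * real K + 1) / (real K + 2) < (1 + \<epsilon>) * alpha s l"
    using eventually_gt_at_top[of 0] by eventually_elim simp
  then obtain K where K: "0 < K" "1 < l * (b K / real K * (real K / (real K + 2)))"
      "(a * real K + 1) / (real K + 2) < (1 + \<epsilon>) * alpha s l"
    using eventually_happens'[OF sequentially_bot ev] by blast
  from K(1,2) have bK: "1 < l * (b K / (real K + 2))" by simp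
  define r where "r = a * real K"
  have r: "0 < r" using a(1) K(1) by (simp add: r_def)
  define M where "M = nat \<lceil>r\<rceil>"
  have M: "0 < M" using r by (simp add: M_def)
  define m where "m N = k N div (K + 2)" for N
  define J where "J N = k N - (m N * K + m N)" for N
  have mk': "m N * (K + 2) \<le> k N" for N
    unfolding m_def by (rule div_times_less_eq_dividend)
  have mk: "m N * K + m N + m N \<le> k N" for N
    using mk'[of N] unfolding distrib_left by linarith
  have kJ: "m N * K + m N + J N = k N" and J_ge: "m N \<le> J N" for N
    using mk[of N] by (simp_all add: J_def)
  have m_ge: "real (k N) / (real K + 2) - 1 \<le> real (m N)" for N
  proof -
    have "k N \<le> (m N + 1) * (K + 2)"
      unfolding m_def using dividend_less_times_div[of "K + 2" "k N"] by (simp add: algebra_simps)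
    then have "real (k N) \<le> real (m N + 1) * real (K + 2)"
      unfolding of_nat_mult[symmetric] of_nat_le_iff .
    then show ?thesis by (simp add: field_simps)
  qed
  have inv_ln: "(\<lambda>N. 1 / ln (n N)) \<longlonglongrightarrow> 0"
    using tendsto_inverse_0_at_top[OF ln_n_lim] by (simp add: inverse_eq_divide)
  have frac_lim: "(\<lambda>N. real (k N) / ln (n N) / (real K + 2) - 1 / ln (n N)) \<longlonglongrightarrow> l / (real K + 2) - 0"
    by (intro tendsto_diff tendsto_divide l(2) inv_ln tendsto_const) simp
  have frac_ge: "\<forall>\<^sub>F N in sequentially.
      real (k N) / ln (n N) / (real K + 2) - 1 / ln (n N) \<le> real (m N) / ln (n N)"
    using eventually_ln_n_gt[of 0]
  proof eventually_elim
    case (elim N)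
    have "(real (k N) / (real K + 2) - 1) / ln (n N) \<le> real (m N) / ln (n N)"
      using m_ge[of N] elim by (intro divide_right_mono) auto
    then show ?case by (simp add: diff_divide_distrib mult.commute)
  qed
  \<comment> \<open>\<open>q\<close> is the limit of \<open>m / ln n\<close>, and half of it is an
    eventual lower bound.\<close>
  define q where "q = l / (real K + 2)"
  define c where "c = q / 2"
  have "0 < q" using l(1) by (simp add: q_def)
  then have "0 < c" "c < q" by (simp_all add: c_def)
  note c = this[unfolded q_def]
  have m_lower: "\<forall>\<^sub>F N in sequentially. c * ln (n N) \<le> real (m N)"
  proof -
    have "\<forall>\<^sub>F N in sequentially. c < real (k N) / ln (n N) / (real K + 2) - 1 / ln (n N)"
      using c(2) by (intro order_tendstoD(1)[OF frac_lim]) simp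
    with frac_ge eventually_ln_n_gt[of 0] show ?thesis
    proof eventually_elim
      case (elim N)
      then have "c \<le> real (m N) / ln (n N)" by linarith
      then show ?case using elim(2) by (simp add: pos_le_divide_eq)
    qed
  qed
  define B where "B = card (word_ball s K r)"
  have B: "0 < B" unfolding B_def using r by (intro card_word_ball_pos) simp
  have lnB: "b K = ln (real B)" by (simp add: b_def B_def r_def)
  define \<eta> where "\<eta> N = real ((2 * M) ^ min_generators (G N)) / 2 ^ m N + n N / (real (B ^ m N) * 2 ^ m N)" for N
  \<comment> \<open>\<open>2 ^ m\<close> is eventually at least \<open>exp (2 * y)\<close>. Once the
    torsion factor is at most \<open>exp y\<close>, the quotient is at most
    \<open>exp (- y)\<close>.\<close>
  define y where "y N = c * ln 2 / 2 * ln (n N)" for N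
  have lim1: "(\<lambda>N. real ((2 * M) ^ min_generators (G N)) / 2 ^ m N) \<longlonglongrightarrow> 0"
  proof (rule tendsto_sandwich[OF _ _ tendsto_const])
    have lnM: "0 < ln (2 * real M)" using M by simp
    have "filterlim (\<lambda>N. ln (ln (n N))) at_top sequentially"
      using ln_at_top ln_n_lim by (rule filterlim_compose)
    then have "\<forall>\<^sub>F N in sequentially. ln (2 * real M) / (2 * c * ln 2) < ln (ln (n N))"
      unfolding filterlim_at_top_dense by blast
    with d m_lower eventually_ln_n_gt[of 1]
    show "\<forall>\<^sub>F N in sequentially. real ((2 * M) ^ min_generators (G N)) / 2 ^ m N \<le> exp (- y N)"
    proof eventually_elim
      case (elim N)
      have LL: "0 < ln (ln (n N))" using elim(3) by simp
      \<comment> \<open>The bound on the number of generators enters here: \<open>2 * M\<close> does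
        not depend on \<open>N\<close>, so the logarithm of the torsion factor is of order
        \<open>ln n / ln (ln n)\<close>, and the threshold for \<open>ln (ln n)\<close> brings it
        below \<open>y\<close>.\<close>
      have "real (min_generators (G N)) * ln (2 * real M) \<le> 1 / 4 * ln (n N) / ln (ln (n N)) * ln (2 * real M)"
        using elim(1) lnM by (intro mult_right_mono) auto
      also have "\<dots> = ln (n N) / 4 * (ln (2 * real M) / ln (ln (n N)))" by simp
      also have "\<dots> \<le> ln (n N) / 4 * (2 * c * ln 2)"
        using elim(3,4) LL c(1) by (intro mult_left_mono) (simp_all add: field_simps)
      finally have d_le: "real (min_generators (G N)) * ln (2 * real M) \<le> y N"
        unfolding y_def by (simp add: mult_ac)
      have "2 * y N = c * ln (n N) * ln 2" unfolding y_def by simp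
      also have "\<dots> \<le> real (m N) * ln 2"
        using elim(2) by (intro mult_right_mono) auto
      finally have "real (min_generators (G N)) * ln (2 * real M) - real (m N) * ln 2 \<le> - y N"
        using d_le by linarith
      moreover have "real ((2 * M) ^ min_generators (G N)) / 2 ^ m N =
          exp (real (min_generators (G N)) * ln (2 * real M) - real (m N) * ln 2)"
        unfolding exp_diff exp_of_nat_mult using M by simp
      ultimately show ?case by simp
    qed
    have "filterlim y at_top sequentially"
      unfolding y_def using c(1) by (intro filterlim_tendsto_pos_mult_at_top[OF tendsto_const] ln_n_lim) simp
    then have "filterlim (\<lambda>N. - y N) at_bot sequentially"
      by (simp add: filterlim_uminus_at_bot)
    then show "(\<lambda>N. exp (- y N)) \<longlonglongrightarrow> 0"
      by (rule filterlim_compose[OF exp_at_bot])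
  qed simp
  have lim2: "(\<lambda>N. n N / (real (B ^ m N) * 2 ^ m N)) \<longlonglongrightarrow> 0"
  proof (rule tendsto_sandwich[OF _ _ tendsto_const])
    show "\<forall>\<^sub>F N in sequentially. 0 \<le> n N / (real (B ^ m N) * 2 ^ m N)"
      by (simp add: n_def)
    have bpos: "0 \<le> b K" unfolding lnB using B by (simp add: Suc_leI)
    \<comment> \<open>The first factor tends to \<open>1 - b K * l / (K + 2)\<close>, negative by
      the choice of \<open>K\<close>; the power \<open>2 ^ m\<close> in the denominator is
      dropped.\<close>
    let ?e = "\<lambda>N. (1 - b K * (real (k N) / ln (n N) / (real K + 2) - 1 / ln (n N))) * ln (n N)"
    show "\<forall>\<^sub>F N in sequentially. n N / (real (B ^ m N) * 2 ^ m N) \<le> exp (?e N)"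
      using frac_ge eventually_ln_n_gt[of 0] eventually_n_gt[of 1]
    proof eventually_elim
      case (elim N)
      have "n N / (real (B ^ m N) * 2 ^ m N) \<le> n N / real (B ^ m N)"
        using B elim(3) by (intro divide_left_mono) (auto simp: mult_le_cancel_left1)
      also have "\<dots> = exp (ln (n N) - real (m N) * b K)"
        unfolding exp_diff exp_of_nat_mult lnB using B elim(3) by simp
      also have "\<dots> = exp ((1 - b K * (real (m N) / ln (n N))) * ln (n N))"
        using elim(2) by (simp add: field_simps)
      also have "\<dots> \<le> exp (?e N)"
        using elim(1,2) bpos by (intro exp_le_cancel_iff[THEN iffD2] mult_right_mono diff_left_mono mult_left_mono) auto
      finally show ?case .
    qed
    have "(\<lambda>N. 1 - b K * (real (k N) / ln (n N) / (real K + 2) - 1 / ln (n N))) \<longlonglongrightarrow> 1 - b K * (l / (real K + 2) - 0)"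
      by (intro tendsto_diff[OF tendsto_const] tendsto_mult[OF tendsto_const] frac_lim)
    moreover have "1 - b K * (l / (real K + 2) - 0) < 0" using bK by (simp add: mult.commute)
    ultimately have "filterlim ?e at_bot sequentially"
      by (rule filterlim_tendsto_neg_mult_at_bot) (rule ln_n_lim)
    then show "(\<lambda>N. exp (?e N)) \<longlonglongrightarrow> 0"
      by (rule filterlim_compose[OF exp_at_bot])
  qed
  have \<eta>_lim: "\<eta> \<longlonglongrightarrow> 0" unfolding \<eta>_def using tendsto_add[OF lim1 lim2] by simp
  have J_lower: "\<forall>\<^sub>F N in sequentially. c * ln (n N) \<le> real (J N)"
    using m_lower
  proof eventually_elim
    case (elim N)
    with J_ge[of N] show ?case by linarith
  qed
  have "0 \<le> \<eta> N" for N unfolding \<eta>_def n_def by (intro add_nonneg_nonneg divide_nonneg_nonneg mult_nonneg_nonneg) auto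
  then have lim: "(\<lambda>N. sqrt (\<eta> N) + n N * sqrt (\<eta> N) ^ J N) \<longlonglongrightarrow> 0"
    by (rule failure_bound_tendsto_0[OF n_lim \<eta>_lim _ c(1) J_lower])
  define R where "R N = nat \<lfloor>real (m N) * r\<rfloor>" for N
  \<comment> \<open>The blocks use at most \<open>m * r\<close>, the binary exponents at most
    \<open>m\<close>, and the last step 1.\<close>
  have R: "real (Suc (R N + m N)) \<le> real (k N) * ((r + 1) / (real K + 2)) + 1" for N
  proof -
    have "real (R N) \<le> real (m N) * r" using r unfolding R_def by (simp add: of_nat_floor)
    then have "real (R N + m N) \<le> real (m N) * (r + 1)" by (simp add: distrib_left)
    also have "\<dots> \<le> real (k N) / (real K + 2) * (r + 1)"
    proof (intro mult_right_mono)
      have "real (m N) * real (K + 2) \<le> real (k N)"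
        unfolding of_nat_mult[symmetric] of_nat_le_iff by (rule mk')
      then show "real (m N) \<le> real (k N) / (real K + 2)" by (simp add: pos_le_divide_eq add.commute)
    qed (use r in simp)
    finally show ?thesis by simp
  qed
  \<comment> \<open>The slack per generator; multiplied by \<open>k\<close> it eventually pays for
    the last step.\<close>
  define \<delta> where "\<delta> = (1 + \<epsilon>) * alpha s l - (r + 1) / (real K + 2)"
  have \<delta>: "0 < \<delta>" using K(3) by (simp add: \<delta>_def r_def)
  have k_large: "\<forall>\<^sub>F N in sequentially. 1 \<le> real (k N) * \<delta>"
  proof -
    have "\<forall>\<^sub>F N in sequentially. l / 2 < real (k N) / ln (n N)"
      using l(1) by (intro order_tendstoD(1)[OF l(2)]) simp
    with eventually_ln_n_gt[of "2 / (l * \<delta>)"] eventually_ln_n_gt[of 0] show ?thesis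
    proof eventually_elim
      case (elim N)
      have "1 \<le> l / 2 * ln (n N) * \<delta>" using elim(1) l(1) \<delta> by (simp add: field_simps)
      also have "\<dots> \<le> real (k N) * \<delta>"
        using elim(2,3) \<delta> by (intro mult_right_mono) (simp_all add: pos_less_divide_eq)
      finally show ?case .
    qed
  qed
  show ?thesis
  proof (rule prob_diam_le_tendsto_1[OF _ lim])
    show "\<forall>\<^sub>F N in sequentially. \<exists>R. 1 - (sqrt (\<eta> N) + n N * sqrt (\<eta> N) ^ J N)
        \<le> measure_pmf.prob (random_generators (G N) (k N)) {Z. cayley_diam s (G N) Z \<le> enat R} \<and>
        real R \<le> (1 + \<epsilon>) * (alpha s l * real (k N))"
      using k_large
    proof eventually_elim
      case (elim N)
      obtain U where U: "finite U" "card U = card (word_ball s K r) ^ m N"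
          "U \<subseteq> word_ball s (m N * K) (real (m N) * r)"
          "\<And>u i. u \<in> U \<Longrightarrow> i \<in> set u \<Longrightarrow> real_of_int \<bar>i\<bar> \<le> r"
        using block_words[of r s K "m N"] r by (metis less_imp_le)
      have "1 - (sqrt (\<eta> N) + real (order (G N)) * sqrt (\<eta> N) ^ J N)
        \<le> measure_pmf.prob (random_generators (G N) (m N * K + m N + J N))
            {Z. cayley_diam s (G N) Z \<le> enat (Suc (R N + m N))}"
      proof (rule comm_group.prob_cayley_diam_le_comm[OF comm fin U(1)])
        show "U \<noteq> {}" using U(2) B unfolding B_def by (metis card.empty power_eq_0_iff less_irrefl)
        show "length u = m N * K \<and> word_length u \<le> R N \<and> (s = Plus \<longrightarrow> (\<forall>i\<in>set u. 0 \<le> i))" if "u \<in> U" for u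
          using that U(3) unfolding word_ball_iff[abs_def] R_def by (auto simp: word_ball_iff le_nat_floor)
        show "\<bar>i\<bar> \<le> int M" if "u \<in> U" "i \<in> set u" for u i
          using U(4)[OF that] unfolding M_def by linarith
        show "real ((2 * M) ^ min_generators (G N)) / 2 ^ m N + real (order (G N)) / (real (card U) * 2 ^ m N) = \<eta> N"
          unfolding \<eta>_def U(2) B_def n_def ..
      qed
      moreover have "real (Suc (R N + m N)) \<le> (1 + \<epsilon>) * (alpha s l * real (k N))"
        using R[of N] elim unfolding \<delta>_def by (simp add: algebra_simps)
      ultimately show ?case unfolding kJ n_def by blast
    qed
  qed
qed

end

theorem theorem3:
  fixes G :: "nat \<Rightarrow> ('a, 'b) monoid_scheme"
    and k :: "nat \<Rightarrow> nat"
    and n :: "nat \<Rightarrow> real"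
    and \<rho> :: "nat \<Rightarrow> real"
  assumes grp: "\<And>N. group (G N)"
    and fin: "\<And>N. finite (carrier (G N))"
    and n_def: "\<And>N. n N = real (order (G N))"
    and n_lim: "filterlim n at_top sequentially"
    and k_pos: "\<And>N. k N > 0"
    and rho_def: "\<And>N. \<rho> N = ln (real (k N)) / ln (ln (n N))"
  shows
    "(\<forall>s l.
        (\<forall>N. comm_group (G N)) \<and> l > 0 \<and> (\<lambda>N. real (k N) / ln (n N)) \<longlonglongrightarrow> l \<and>
        (\<forall>\<^sub>F N in sequentially.
           real (min_generators (G N)) \<le> 1 / 4 * ln (n N) / ln (ln (n N))) \<and>
        filterlim (\<lambda>N. m_star (G N)) at_top sequentially \<longrightarrow>
        tendsto_in_prob (\<lambda>N. random_generators (G N) (k N))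
          (\<lambda>N Z. ereal_of_enat (cayley_diam s (G N) Z) / ereal (alpha s l * real (k N))) 1)
   \<and> (\<forall>s.
        (\<forall>N. comm_group (G N)) \<and>
        filterlim (\<lambda>N. real (k N) / ln (n N)) at_top sequentially \<and>
        (\<lambda>N. ln (real (k N)) / ln (n N)) \<longlonglongrightarrow> 0 \<longrightarrow>
        tendsto_in_prob (\<lambda>N. random_generators (G N) (k N))
          (\<lambda>N Z. ereal_of_enat (cayley_diam s (G N) Z) /
                   ereal (\<rho> N / (\<rho> N - 1) * log (real (k N)) (n N))) 1)
   \<and> (\<forall>s \<epsilon>.
        filterlim (\<lambda>N. real (k N) / ln (n N)) at_top sequentially \<and>
        (\<lambda>N. ln (real (k N)) / ln (n N)) \<longlonglongrightarrow> 0 \<and> \<epsilon> > 0 \<longrightarrow>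
        (\<lambda>N. measure_pmf.prob (random_generators (G N) (k N))
           {Z. ereal_of_enat (cayley_diam s (G N) Z)
                 \<le> ereal ((1 + \<epsilon>) * (\<rho> N / (\<rho> N - 1)) * log (real (k N)) (n N))}) \<longlonglongrightarrow> 1)
   \<and> (\<forall>s l \<epsilon>.
        (\<forall>N. comm_group (G N)) \<and> l > 0 \<and> (\<lambda>N. real (k N) / ln (n N)) \<longlonglongrightarrow> l \<and> \<epsilon> > 0 \<longrightarrow>
        (\<forall>\<^sub>F N in sequentially. \<forall>z. set_mset z \<subseteq> carrier (G N) \<and> size z = k N \<longrightarrow>
           ereal_of_enat (cayley_diam s (G N) z)
             \<ge> ereal ((1 - \<epsilon>) * alpha s l * real (k N))))
   \<and> (\<forall>s \<epsilon>.
        (\<forall>N. comm_group (G N)) \<and>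
        filterlim (\<lambda>N. real (k N) / ln (n N)) at_top sequentially \<and>
        (\<lambda>N. ln (real (k N)) / ln (n N)) \<longlonglongrightarrow> 0 \<and> \<epsilon> > 0 \<longrightarrow>
        (\<forall>\<^sub>F N in sequentially. \<forall>z. set_mset z \<subseteq> carrier (G N) \<and> size z = k N \<longrightarrow>
           ereal_of_enat (cayley_diam s (G N) z)
             \<ge> ereal ((1 - \<epsilon>) * (\<rho> N / (\<rho> N - 1)) * log (real (k N)) (n N))))"
proof -
  interpret random_cayley G k n
    using grp fin n_def n_lim k_pos by (rule random_cayley.intro)
  \<comment> \<open>Carries bounds valid for all multisets of \<open>k\<close> elements over to
    every value of the random multiset.\<close>
  have support: "set_mset z \<subseteq> carrier (G N) \<and> size z = k N"
    if "z \<in> set_pmf (random_generators (G N) (k N))" for z N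
  proof -
    have "carrier (G N) \<noteq> {}" using group.is_monoid[OF grp] monoid.one_closed by blast
    from set_pmf_random_generators[OF fin this that] show ?thesis by blast
  qed
  have linear: "tendsto_in_prob (\<lambda>N. random_generators (G N) (k N))
      (\<lambda>N Z. ereal_of_enat (cayley_diam s (G N) Z) / ereal (alpha s l * real (k N))) 1"
    if comm: "\<And>N. comm_group (G N)" and l: "l > 0" "(\<lambda>N. real (k N) / ln (n N)) \<longlonglongrightarrow> l"
      and d: "\<forall>\<^sub>F N in sequentially. real (min_generators (G N)) \<le> 1 / 4 * ln (n N) / ln (ln (n N))" for s l
  proof (rule tendsto_in_probI)
    show "\<forall>\<^sub>F N in sequentially. 0 < alpha s l * real (k N)"
      using alpha_pos[OF l(1)] k_pos by simp
    fix \<epsilon> :: real assume \<epsilon>: "0 < \<epsilon>"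
    show "\<forall>\<^sub>F N in sequentially. \<forall>Z\<in>set_pmf (random_generators (G N) (k N)).
        ereal ((1 - \<epsilon>) * (alpha s l * real (k N))) \<le> ereal_of_enat (cayley_diam s (G N) Z)"
      using lower_bound_linear[OF comm l \<epsilon>, of s]
    proof eventually_elim
      case (elim N)
      with support[of _ N] show ?case unfolding mult.assoc by blast
    qed
    show "(\<lambda>N. measure_pmf.prob (random_generators (G N) (k N))
        {Z. ereal_of_enat (cayley_diam s (G N) Z) \<le> ereal ((1 + \<epsilon>) * (alpha s l * real (k N)))}) \<longlonglongrightarrow> 1"
      by (rule upper_bound_linear[OF comm l d \<epsilon>])
  qed
  \<comment> \<open>The formula in \<open>\<rho>\<close> is identified with
    \<open>typical_radius\<close> only for large \<open>N\<close>, once \<open>ln n > 1\<close> and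
    \<open>k > ln n\<close>; hence the passage through eventual equality.\<close>
  have upper: "(\<lambda>N. measure_pmf.prob (random_generators (G N) (k N))
      {Z. ereal_of_enat (cayley_diam s (G N) Z)
        \<le> ereal ((1 + \<epsilon>) * (\<rho> N / (\<rho> N - 1) * log (real (k N)) (n N)))}) \<longlonglongrightarrow> 1"
    if \<kappa>: "filterlim (\<lambda>N. real (k N) / ln (n N)) at_top sequentially"
      and k0: "(\<lambda>N. ln (real (k N)) / ln (n N)) \<longlonglongrightarrow> 0" and \<epsilon>: "\<epsilon> > 0" for s \<epsilon>
  proof (rule Lim_transform_eventually[OF upper_bound_superlinear[OF \<kappa> k0 \<epsilon>, of s]])
    show "\<forall>\<^sub>F N in sequentially.
        measure_pmf.prob (random_generators (G N) (k N))
          {Z. ereal_of_enat (cayley_diam s (G N) Z) \<le> ereal ((1 + \<epsilon>) * typical_radius N)} =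
        measure_pmf.prob (random_generators (G N) (k N))
          {Z. ereal_of_enat (cayley_diam s (G N) Z)
            \<le> ereal ((1 + \<epsilon>) * (\<rho> N / (\<rho> N - 1) * log (real (k N)) (n N)))}"
      using eventually_typical_radius[OF \<kappa> rho_def] by eventually_elim simp
  qed
  have lower: "\<forall>\<^sub>F N in sequentially. \<forall>z. set_mset z \<subseteq> carrier (G N) \<and> size z = k N \<longrightarrow>
      ereal_of_enat (cayley_diam s (G N) z)
        \<ge> ereal ((1 - \<epsilon>) * (\<rho> N / (\<rho> N - 1) * log (real (k N)) (n N)))"
    if comm: "\<And>N. comm_group (G N)" and \<kappa>: "filterlim (\<lambda>N. real (k N) / ln (n N)) at_top sequentially"
      and \<epsilon>: "\<epsilon> > 0" for s \<epsilon>
    using lower_bound_superlinear[OF \<kappa> comm \<epsilon>, of s] eventually_typical_radius[OF \<kappa> rho_def]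
    by eventually_elim simp
  have superlinear: "tendsto_in_prob (\<lambda>N. random_generators (G N) (k N))
      (\<lambda>N Z. ereal_of_enat (cayley_diam s (G N) Z) /
        ereal (\<rho> N / (\<rho> N - 1) * log (real (k N)) (n N))) 1"
    if comm: "\<And>N. comm_group (G N)" and \<kappa>: "filterlim (\<lambda>N. real (k N) / ln (n N)) at_top sequentially"
      and k0: "(\<lambda>N. ln (real (k N)) / ln (n N)) \<longlonglongrightarrow> 0" for s
  proof (rule tendsto_in_probI)
    show "\<forall>\<^sub>F N in sequentially. 0 < \<rho> N / (\<rho> N - 1) * log (real (k N)) (n N)"
      using eventually_typical_radius_pos[OF \<kappa>] eventually_typical_radius[OF \<kappa> rho_def]
      by eventually_elim (simp only:)
    fix \<epsilon> :: real assume \<epsilon>: "0 < \<epsilon>"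
    show "\<forall>\<^sub>F N in sequentially. \<forall>Z\<in>set_pmf (random_generators (G N) (k N)).
        ereal ((1 - \<epsilon>) * (\<rho> N / (\<rho> N - 1) * log (real (k N)) (n N))) \<le> ereal_of_enat (cayley_diam s (G N) Z)"
      using lower[OF comm \<kappa> \<epsilon>, of s]
    proof eventually_elim
      case (elim N)
      with support[of _ N] show ?case by blast
    qed
  qed (rule upper[OF \<kappa> k0])
  show ?thesis
  proof (intro conjI allI impI; (elim conjE)?)
    fix s \<epsilon>
    assume "filterlim (\<lambda>N. real (k N) / ln (n N)) at_top sequentially"
      "(\<lambda>N. ln (real (k N)) / ln (n N)) \<longlonglongrightarrow> 0" "\<epsilon> > (0::real)"
    then show "(\<lambda>N. measure_pmf.prob (random_generators (G N) (k N))
           {Z. ereal_of_enat (cayley_diam s (G N) Z)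
                 \<le> ereal ((1 + \<epsilon>) * (\<rho> N / (\<rho> N - 1)) * log (real (k N)) (n N))}) \<longlonglongrightarrow> 1"
      unfolding mult.assoc by (rule upper)
  next
    fix s \<epsilon>
    assume "\<forall>N. comm_group (G N)" "filterlim (\<lambda>N. real (k N) / ln (n N)) at_top sequentially" "\<epsilon> > (0::real)"
    then show "\<forall>\<^sub>F N in sequentially. \<forall>z. set_mset z \<subseteq> carrier (G N) \<and> size z = k N \<longrightarrow>
           ereal_of_enat (cayley_diam s (G N) z)
             \<ge> ereal ((1 - \<epsilon>) * (\<rho> N / (\<rho> N - 1)) * log (real (k N)) (n N))"
      unfolding mult.assoc by (intro lower) auto
  qed (blast intro: linear superlinear lower_bound_linear)+
qed

end
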